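(* Let $M$ be a nonderogatory $n\times n$ real matrix. Suppose $M$ has $p$ distinct real eigenvalues $\lambda_1,\dots,\lambda_p$ with respective multiplicities $k_1,\dots,k_p$ and $2q$ distinct complex (nonreal) eigenvalues $z_1,\bar z_1,\dots,z_q,\bar z_q$ with respective multiplicities $m_1,\dots,m_q$, where $n=k_1+\dots+k_p+2(m_1+\dots+m_q)$. Then the Lie algebra $\mathcal G_M:=\mathbb R[M]\ltimes\mathbb R^n$ is isomorphic to the direct sum $$\mathfrak D_0^{k_1}\oplus\dots\oplus\mathfrak D_0^{k_p}\oplus\mathfrak D_{0,1}^{2m_1}\oplus\dots\oplus\mathfrak D_{0,1}^{2m_q}.$$ In particular, for a real $n\times n$ nonderogatory matrix $M$: (a) if $M$ admits $n$ distinct real eigenvalues, then $\mathcal G_M$ is isomorphic to the direct sum of $n$ copies of $\mathfrak{aff}(\mathbb R)$, the Lie algebra of the group of affine motions of the real line; (b) if $M$ admits a unique eigenvalue $\lambda$, which is real, then $\mathcal G_M$ is isomorphic to $\mathfrak D_0^n$; (c) if $M$ admits $n$ distinct complex (nonreal) eigenvalues, then $\mathcal G_M$ is isomorphic to the direct sum of $n/2$ copies of $\mathfrak{aff}(\mathbb C)$, the Lie algebra of the group of affine motions of the complex line seen as a real Lie algebra; (d) if $M$ admits only two eigenvalues, which are both complex (nonreal) and hence conjugate, then $\mathcal G_M$ is isomorphic to $\mathfrak D_{0,1}^n$.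
   Context: A square matrix is nonderogatory if its characteristic and minimal polynomials coincide. $\mathbb R[M]$ is the algebra of real polynomials in $M$, and $\mathcal G_M:=\mathbb R[M]\ltimes\mathbb R^n$ is the vector space $\mathbb R[M]\oplus\mathbb R^n$ with Lie bracket $[a,b]=[x,y]=0$, $[a,x]=ax$ for $a,b\in\mathbb R[M]$, $x,y\in\mathbb R^n$. A pair of conjugate nonreal eigenvalues $z,\bar z$ has multiplicity $m$ if $m$ is the greatest integer such that $\big((X-\mathrm{Re}(z))^2+\mathrm{Im}(z)^2\big)^m$ divides the characteristic polynomial. Let $E_{i,j}$ be the $n\times n$ matrix with $(i,j)$ entry $1$ and all others $0$. For $n\ge1$, $\mathfrak D_0^n:=\mathcal G_{M_0}$ with $M_0=\sum_{i=1}^{n-1}E_{i,i+1}$ (so $M_0=0$ when $n=1$); $\mathfrak D_0^1=\mathfrak{aff}(\mathbb R)$ is the 2-dimensional Lie algebra with $[e_1,e_2]=e_2$. For even $n\ge2$, $\mathfrak D_{0,1}^n:=\mathcal G_{M_{0,1}}$ where $M_{0,1}=-\sum_{j=0}^{n/2-1}(E_{2j+1,2j+2}-E_{2j+2,2j+1})+\sum_{j=1}^{n-2}E_{j,j+2}$ (the second sum being empty for $n=2$); $\mathfrak D_{0,1}^n$ has dimension $2n$. $\mathfrak D_{0,1}^2=\mathfrak{aff}(\mathbb C)$ is the 4-dimensional real Lie algebra with nonzero brackets $[e_1,e_3]=e_3$, $[e_1,e_4]=e_4$, $[e_2,e_3]=e_4$, $[e_2,e_4]=-e_3$. *)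

theory Defs
  imports "Jordan_Normal_Form.Spectral_Radius"
begin

section \<open>Real Lie algebras\<close>

text \<open>
  The underlying real vector space is a HOL-Algebra module over \<^term>\<open>class_ring\<close>; as for
  \<^const>\<open>module_vec\<close>, the inherited ring fields \<open>mult\<close> and \<open>one\<close> are left \<open>undefined\<close>.
\<close>

record 'a lie_algebra = "(real, 'a) module" +
  bracket :: "'a \<Rightarrow> 'a \<Rightarrow> 'a"

locale real_lie_algebra = Module.module "class_ring :: real ring" L
  for L :: "'a lie_algebra" (structure) +
  assumes bracket_closed: "\<lbrakk>x \<in> carrier L; y \<in> carrier L\<rbrakk> \<Longrightarrow> bracket L x y \<in> carrier L"
    and bracket_add_left: "\<lbrakk>x \<in> carrier L; y \<in> carrier L; z \<in> carrier L\<rbrakk>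
      \<Longrightarrow> bracket L (x \<oplus> y) z = bracket L x z \<oplus> bracket L y z"
    and bracket_add_right: "\<lbrakk>x \<in> carrier L; y \<in> carrier L; z \<in> carrier L\<rbrakk>
      \<Longrightarrow> bracket L x (y \<oplus> z) = bracket L x y \<oplus> bracket L x z"
    and bracket_smult_left: "\<lbrakk>x \<in> carrier L; y \<in> carrier L\<rbrakk>
      \<Longrightarrow> bracket L (c \<odot> x) y = c \<odot> bracket L x y"
    and bracket_smult_right: "\<lbrakk>x \<in> carrier L; y \<in> carrier L\<rbrakk>
      \<Longrightarrow> bracket L x (c \<odot> y) = c \<odot> bracket L x y"
    and bracket_self: "x \<in> carrier L \<Longrightarrow> bracket L x x = \<zero>"
    and jacobi: "\<lbrakk>x \<in> carrier L; y \<in> carrier L; z \<in> carrier L\<rbrakk>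
      \<Longrightarrow> bracket L x (bracket L y z) \<oplus> bracket L y (bracket L z x) \<oplus> bracket L z (bracket L x y) = \<zero>"

definition lie_iso :: "'a lie_algebra \<Rightarrow> 'b lie_algebra \<Rightarrow> ('a \<Rightarrow> 'b) set" where
  "lie_iso L L' = {f \<in> module_hom class_ring L L'. bij_betw f (carrier L) (carrier L') \<and>
     (\<forall>x\<in>carrier L. \<forall>y\<in>carrier L. f (bracket L x y) = bracket L' (f x) (f y))}"

definition lie_isomorphic :: "'a lie_algebra \<Rightarrow> 'b lie_algebra \<Rightarrow> bool" (infix \<open>\<cong>\<^sub>L\<close> 50) where
  "L \<cong>\<^sub>L L' \<longleftrightarrow> lie_iso L L' \<noteq> {}"

definition lie_direct_sum :: "'i set \<Rightarrow> ('i \<Rightarrow> 'a lie_algebra) \<Rightarrow> ('i \<Rightarrow> 'a) lie_algebra" where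
  "lie_direct_sum I L = \<lparr>
     carrier = {x \<in> (\<Pi>\<^sub>E i\<in>I. carrier (L i)). finite {i \<in> I. x i \<noteq> \<zero>\<^bsub>L i\<^esub>}},
     mult = undefined,
     one = undefined,
     zero = (\<lambda>i\<in>I. \<zero>\<^bsub>L i\<^esub>),
     add = (\<lambda>x y. \<lambda>i\<in>I. x i \<oplus>\<^bsub>L i\<^esub> y i),
     smult = (\<lambda>c x. \<lambda>i\<in>I. c \<odot>\<^bsub>L i\<^esub> x i),
     bracket = (\<lambda>x y. \<lambda>i\<in>I. bracket (L i) (x i) (y i))\<rparr>"


section \<open>Polynomials in a matrix\<close>

definition poly_mat :: "'a::comm_ring_1 poly \<Rightarrow> 'a mat \<Rightarrow> 'a mat" where
  "poly_mat f A = mat (dim_row A) (dim_row A) (\<lambda>(i, j). \<Sum>k\<le>degree f. coeff f k * (A ^\<^sub>m k) $$ (i, j))"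

lemma poly_mat_dim [simp]:
  "dim_row (poly_mat f A) = dim_row A" "dim_col (poly_mat f A) = dim_row A"
  by (simp_all add: poly_mat_def)

lemma poly_mat_index:
  assumes "i < dim_row A" "j < dim_row A" "degree f \<le> N"
  shows "poly_mat f A $$ (i, j) = (\<Sum>k\<le>N. coeff f k * (A ^\<^sub>m k) $$ (i, j))"
proof -
  have "(\<Sum>k\<le>degree f. coeff f k * (A ^\<^sub>m k) $$ (i, j)) = (\<Sum>k\<le>N. coeff f k * (A ^\<^sub>m k) $$ (i, j))"
    using assms(3) by (intro sum.mono_neutral_left) (auto simp: coeff_eq_0)
  with assms show ?thesis by (simp add: poly_mat_def)
qed

lemma poly_mat_add: "poly_mat (f + g) A = poly_mat f A + poly_mat g A"
proof (rule eq_matI)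
  fix i j assume ij: "i < dim_row (poly_mat f A + poly_mat g A)" "j < dim_col (poly_mat f A + poly_mat g A)"
  let ?N = "max (degree f) (degree g)"
  have "degree (f + g) \<le> ?N" by (rule degree_add_le_max)
  with ij show "poly_mat (f + g) A $$ (i, j) = (poly_mat f A + poly_mat g A) $$ (i, j)"
    by (simp add: poly_mat_index[where N = ?N] sum.distrib algebra_simps)
qed simp_all

lemma poly_mat_smult: "poly_mat (Polynomial.smult c f) A = c \<cdot>\<^sub>m poly_mat f A"
proof (rule eq_matI)
  fix i j assume ij: "i < dim_row (c \<cdot>\<^sub>m poly_mat f A)" "j < dim_col (c \<cdot>\<^sub>m poly_mat f A)"
  with degree_smult_le[of c f] show "poly_mat (Polynomial.smult c f) A $$ (i, j) = (c \<cdot>\<^sub>m poly_mat f A) $$ (i, j)"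
    by (simp add: poly_mat_index[where N = "degree f"] sum_distrib_left algebra_simps)
qed simp_all

definition is_min_poly :: "'a::field mat \<Rightarrow> 'a poly \<Rightarrow> bool" where
  "is_min_poly A f \<longleftrightarrow> monic f \<and> poly_mat f A = 0\<^sub>m (dim_row A) (dim_row A) \<and>
     (\<forall>g. g \<noteq> 0 \<and> poly_mat g A = 0\<^sub>m (dim_row A) (dim_row A) \<longrightarrow> degree f \<le> degree g)"

definition min_poly :: "'a::field mat \<Rightarrow> 'a poly" where
  "min_poly A = (THE f. is_min_poly A f)"

lemma exists_annihilating_poly:
  fixes A :: "'a::field mat"
  assumes "A \<in> carrier_mat n n"
  shows "\<exists>f. f \<noteq> 0 \<and> poly_mat f A = 0\<^sub>m n n"
proof -
  let ?d = "n * n + 1"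
  define c where "c = (\<lambda>r. vec ?d (\<lambda>k. (A ^\<^sub>m k) $$ (r div n, r mod n)))"
  define B where "B = mat\<^sub>r ?d ?d (\<lambda>r. if r = n * n then 0\<^sub>v ?d else c r)"
  have B: "B \<in> carrier_mat ?d ?d" by (simp add: B_def)
  have "det B = 0"
    unfolding B_def by (rule det_row_0) (auto simp: c_def)
  then obtain v where v: "v \<in> carrier_vec ?d" "v \<noteq> 0\<^sub>v ?d" "B *\<^sub>v v = 0\<^sub>v ?d"
    using det_0_iff_vec_prod_zero_field[OF B] by blast
  define f where "f = (\<Sum>k\<le>n * n. monom (v $ k) k)"
  have cf: "coeff f k = (if k \<le> n * n then v $ k else 0)" for k
    by (simp add: f_def coeff_sum sum.delta' if_distrib cong: if_cong)
  have "f \<noteq> 0"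
  proof
    assume "f = 0"
    then have "v $ k = 0" if "k < ?d" for k using cf[of k] that by simp
    with v show False by (auto intro: eq_vecI)
  qed
  moreover have "poly_mat f A = 0\<^sub>m n n"
  proof (rule eq_matI)
    fix i j assume "i < dim_row (0\<^sub>m n n :: 'a mat)" "j < dim_col (0\<^sub>m n n :: 'a mat)"
    then have ij: "i < n" "j < n" by simp_all
    define r where "r = i * n + j"
    have r: "r < n * n" "r div n = i" "r mod n = j"
      using ij mult_le_mono1[of "Suc i" n n] by (auto simp: r_def)
    have "degree f \<le> n * n" by (rule degree_le) (simp add: cf)
    then have "poly_mat f A $$ (i, j) = (\<Sum>k\<le>n * n. v $ k * (A ^\<^sub>m k) $$ (i, j))"
      using ij assms by (simp add: poly_mat_index cf)
    also have "\<dots> = (B *\<^sub>v v) $ r"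
      using r v(1) B by (auto simp: scalar_prod_def B_def c_def mult.commute lessThan_Suc_atMost atLeast0LessThan intro!: sum.cong)
    finally show "poly_mat f A $$ (i, j) = 0\<^sub>m n n $$ (i, j)" using v r ij by simp
  qed (use assms in auto)
  ultimately show ?thesis by blast
qed

lemma is_min_poly_unique:
  assumes f: "is_min_poly A f" and g: "is_min_poly A g"
  shows "f = g"
proof (rule ccontr)
  assume "f \<noteq> g"
  have fg: "f \<noteq> 0" "g \<noteq> 0" using f g by (auto simp: is_min_poly_def)
  with f g have deg: "degree f = degree g" unfolding is_min_poly_def by (meson le_antisym)
  define h where "h = f + Polynomial.smult (- 1) g"
  have h: "h \<noteq> 0" using \<open>f \<noteq> g\<close> by (simp add: h_def)
  have "poly_mat h A = 0\<^sub>m (dim_row A) (dim_row A)"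
    using f g by (simp add: h_def poly_mat_add poly_mat_smult is_min_poly_def del: smult_minus_left)
  then have "degree f \<le> degree h" using f h unfolding is_min_poly_def by blast
  moreover have "coeff h (degree f) = 0"
    using f g deg by (simp add: h_def is_min_poly_def)
  moreover have "degree h \<le> degree f"
    unfolding h_def using deg by (intro degree_add_le) simp_all
  ultimately show False using h by (metis le_antisym leading_coeff_0_iff)
qed

lemma is_min_poly_min_poly:
  assumes A: "A \<in> carrier_mat n n"
  shows "is_min_poly A (min_poly A)"
proof -
  let ?P = "\<lambda>f. f \<noteq> 0 \<and> poly_mat f A = 0\<^sub>m (dim_row A) (dim_row A)"
  obtain f where f: "?P f" "\<And>g. ?P g \<Longrightarrow> degree f \<le> degree g"
    using exists_annihilating_poly[OF A] ex_has_least_nat[of ?P _ degree] A by auto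
  have "is_min_poly A (Polynomial.smult (inverse (lead_coeff f)) f)"
    using f by (simp add: is_min_poly_def poly_mat_smult)
  then show ?thesis
    unfolding min_poly_def by (rule theI) (rule is_min_poly_unique[OF _ \<open>is_min_poly A _\<close>])
qed

lemma pow_mat_add_exp:
  fixes A :: "'a::comm_ring_1 mat"
  assumes A: "A \<in> carrier_mat n n"
  shows "A ^\<^sub>m (k + l) = A ^\<^sub>m k * A ^\<^sub>m l"
proof (induction l)
  case (Suc l)
  with A show ?case
    using assoc_mult_mat[of "A ^\<^sub>m k" n n "A ^\<^sub>m l" n A n] by simp
qed (use A in simp)

lemma poly_mat_mult_index:
  assumes A: "A \<in> carrier_mat n n" and ij: "i < n" "j < n"
  shows "(poly_mat f A * poly_mat g A) $$ (i, j) =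
    (\<Sum>k\<le>degree f. \<Sum>l\<le>degree g. coeff f k * coeff g l * (A ^\<^sub>m (k + l)) $$ (i, j))"
proof -
  have "(poly_mat f A * poly_mat g A) $$ (i, j) = (\<Sum>r<n. poly_mat f A $$ (i, r) * poly_mat g A $$ (r, j))"
    using A ij by (simp add: scalar_prod_def atLeast0LessThan)
  also have "\<dots> = (\<Sum>r<n. \<Sum>k\<le>degree f. \<Sum>l\<le>degree g.
      coeff f k * coeff g l * ((A ^\<^sub>m k) $$ (i, r) * (A ^\<^sub>m l) $$ (r, j)))"
    using A ij by (intro sum.cong) (auto simp: poly_mat_index[OF _ _ order_refl] sum_product algebra_simps)
  also have "\<dots> = (\<Sum>k\<le>degree f. \<Sum>r<n. \<Sum>l\<le>degree g.
      coeff f k * coeff g l * ((A ^\<^sub>m k) $$ (i, r) * (A ^\<^sub>m l) $$ (r, j)))"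
    by (rule sum.swap)
  also have "\<dots> = (\<Sum>k\<le>degree f. \<Sum>l\<le>degree g. \<Sum>r<n.
      coeff f k * coeff g l * ((A ^\<^sub>m k) $$ (i, r) * (A ^\<^sub>m l) $$ (r, j)))"
    by (intro sum.cong refl sum.swap)
  also have "\<dots> = (\<Sum>k\<le>degree f. \<Sum>l\<le>degree g. coeff f k * coeff g l * (A ^\<^sub>m (k + l)) $$ (i, j))"
    using A ij by (simp add: pow_mat_add_exp[OF A] scalar_prod_def atLeast0LessThan sum_distrib_left)
  finally show ?thesis .
qed

lemma poly_mat_commute:
  assumes A: "A \<in> carrier_mat n n"
  shows "poly_mat f A * poly_mat g A = poly_mat g A * poly_mat f A"
proof (rule eq_matI)
  fix i j assume "i < dim_row (poly_mat g A * poly_mat f A)" "j < dim_col (poly_mat g A * poly_mat f A)"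
  then have ij: "i < n" "j < n" using A by simp_all
  show "(poly_mat f A * poly_mat g A) $$ (i, j) = (poly_mat g A * poly_mat f A) $$ (i, j)"
    unfolding poly_mat_mult_index[OF A ij]
    by (subst sum.swap) (simp add: mult.commute add.commute)
qed (use A in simp_all)

definition nonderogatory :: "'a::field mat \<Rightarrow> bool" where
  "nonderogatory A \<longleftrightarrow> square_mat A \<and> char_poly A = min_poly A"

definition poly_algebra :: "real mat \<Rightarrow> real mat set" where
  "poly_algebra M = range (\<lambda>f. poly_mat f M)"

text \<open>
  Multiplicity of the conjugate pair \<open>z\<close>, \<open>cnj z\<close>: the divisor is \<open>(X - Re z)^2 + (Im z)^2\<close>.
\<close>

definition conj_pair_multiplicity :: "real mat \<Rightarrow> complex \<Rightarrow> nat" where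
  "conj_pair_multiplicity M z =
     (GREATEST e. ([:- Re z, 1:]^2 + [:(Im z)^2:]) ^ e dvd char_poly M)"

abbreviation complexify :: "real mat \<Rightarrow> complex mat" where
  "complexify \<equiv> map_mat complex_of_real"


section \<open>The Lie algebras of the classification\<close>

text \<open>
  A pair \<open>(a, x)\<close> stands for \<open>a + x\<close>.  The bracket is the bilinear, antisymmetric extension of
  \<open>[a, b] = [x, y] = 0\<close> and \<open>[a, x] = a x\<close>.
\<close>

definition lie_G :: "real mat \<Rightarrow> (real mat \<times> real vec) lie_algebra" where
  "lie_G M = (let n = dim_row M in \<lparr>
     carrier = poly_algebra M \<times> carrier_vec n,
     mult = undefined,
     one = undefined,
     zero = (0\<^sub>m n n, 0\<^sub>v n),
     add = (\<lambda>(a, x) (b, y). (a + b, x + y)),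
     smult = (\<lambda>c (a, x). (c \<cdot>\<^sub>m a, c \<cdot>\<^sub>v x)),
     bracket = (\<lambda>(a, x) (b, y). (0\<^sub>m n n, a *\<^sub>v y - b *\<^sub>v x))\<rparr>)"

text \<open>
  With \<open>E(i, j)\<close> the matrix units (1-based subscripts), this is \<open>E(i, i+1)\<close> summed over
  \<open>1 \<le> i \<le> n-1\<close>.  Matrix indices start at 0 here, so all subscripts are shifted by one.
\<close>

definition M0 :: "nat \<Rightarrow> real mat" where
  "M0 n = mat n n (\<lambda>(i, j). if j = i + 1 then 1 else 0)"

text \<open>
  For even \<open>n\<close>: \<open>- (E(2j+1, 2j+2) - E(2j+2, 2j+1))\<close> summed over \<open>0 \<le> j < n/2\<close>, plus
  \<open>E(j, j+2)\<close> summed over \<open>1 \<le> j \<le> n-2\<close>, with 1-based subscripts.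
\<close>

definition M01 :: "nat \<Rightarrow> real mat" where
  "M01 n = mat n n (\<lambda>(i, j).
     if even i \<and> j = i + 1 then - 1
     else if even j \<and> i = j + 1 then 1
     else if j = i + 2 then 1
     else 0)"

definition D0 :: "nat \<Rightarrow> (real mat \<times> real vec) lie_algebra" where
  "D0 n = lie_G (M0 n)"

text \<open>The next algebra is only meaningful for even \<open>n\<close>.\<close>

definition D01 :: "nat \<Rightarrow> (real mat \<times> real vec) lie_algebra" where
  "D01 n = lie_G (M01 n)"

text \<open>
  The algebra with basis \<open>unit_vec d 0, \<dots>, unit_vec d (d - 1)\<close> in which the bracket of the \<open>i\<close>-th and
  the \<open>j\<close>-th basis vector is \<open>b i j\<close> for \<open>i < j\<close>.
\<close>

definition lie_of_brackets :: "nat \<Rightarrow> (nat \<Rightarrow> nat \<Rightarrow> real vec) \<Rightarrow> real vec lie_algebra" where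
  "lie_of_brackets d b = \<lparr>
     carrier = carrier_vec d,
     mult = undefined,
     one = undefined,
     zero = 0\<^sub>v d,
     add = (+),
     smult = (\<cdot>\<^sub>v),
     bracket = (\<lambda>x y. vec d (\<lambda>l. \<Sum>j<d. \<Sum>i<j. (x $ i * y $ j - x $ j * y $ i) * b i j $ l))\<rparr>"

definition aff_R :: "real vec lie_algebra" where
  "aff_R = lie_of_brackets 2 (\<lambda>_ _. unit_vec 2 1)"

definition aff_C :: "real vec lie_algebra" where
  "aff_C = lie_of_brackets 4 (\<lambda>i j.
     if (i, j) = (0, 2) then unit_vec 4 2
     else if (i, j) = (0, 3) then unit_vec 4 3
     else if (i, j) = (1, 2) then unit_vec 4 3
     else if (i, j) = (1, 3) then - unit_vec 4 2
     else 0\<^sub>v 4)"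


section \<open>The algebras above are Lie algebras\<close>

lemma real_lie_algebra_lie_G:
  assumes M: "M \<in> carrier_mat n n"
  shows "real_lie_algebra (lie_G M)"
proof -
  have P: "a \<in> carrier_mat n n" if "a \<in> poly_algebra M" for a
    using that M by (auto simp: poly_algebra_def)
  have P_dim: "dim_row a = n" "dim_col a = n" if "a \<in> poly_algebra M" for a
    using P[OF that] by simp_all
  have P_zero: "0\<^sub>m n n \<in> poly_algebra M"
    using M by (auto simp: poly_algebra_def poly_mat_def intro!: image_eqI[of _ _ 0])
  have P_add: "a + b \<in> poly_algebra M" if "a \<in> poly_algebra M" "b \<in> poly_algebra M" for a b
    using that by (auto simp: poly_algebra_def poly_mat_add[symmetric])
  have P_smult: "c \<cdot>\<^sub>m a \<in> poly_algebra M" if "a \<in> poly_algebra M" for a c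
    using that by (auto simp: poly_algebra_def poly_mat_smult[symmetric])
  have P_comm: "a *\<^sub>v (b *\<^sub>v x) = b *\<^sub>v (a *\<^sub>v x)"
    if "a \<in> poly_algebra M" "b \<in> poly_algebra M" "x \<in> carrier_vec n" for a b x
    using that P assoc_mult_mat_vec[of a n n b n x] assoc_mult_mat_vec[of b n n a n x] poly_mat_commute[OF M]
    by (auto simp: poly_algebra_def)
  note defs = lie_G_def Let_def
  have [simp]: "dim_row M = n" using M by simp
  have "abelian_group (lie_G M)"
  proof (rule abelian_groupI)
    fix X assume "X \<in> carrier (lie_G M)"
    then obtain a x where X: "X = (a, x)" "a \<in> poly_algebra M" "x \<in> carrier_vec n"
      by (auto simp: defs)
    then show "\<exists>Y\<in>carrier (lie_G M). Y \<oplus>\<^bsub>lie_G M\<^esub> X = \<zero>\<^bsub>lie_G M\<^esub>"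
      using P[of a] P_smult[of a "- 1"]
      by (intro bexI[of _ "(- 1 \<cdot>\<^sub>m a, - 1 \<cdot>\<^sub>v x)"]) (auto simp: defs intro!: eq_matI eq_vecI)
  qed (auto simp: defs P_zero P_add P_dim intro!: eq_matI eq_vecI)
  then have mod_G: "module (class_ring :: real ring) (lie_G M)"
    by (intro moduleI) (auto simp: defs class_cring.is_cring P_smult P_dim distrib_left distrib_right mult.assoc intro!: eq_matI eq_vecI)
  have mv_smult_mat: "(c \<cdot>\<^sub>m a) *\<^sub>v x = c \<cdot>\<^sub>v (a *\<^sub>v x)"
    if "a \<in> poly_algebra M" "x \<in> carrier_vec n" for a x c
    using that by (intro eq_vecI) (auto simp: P_dim scalar_prod_def sum_distrib_left mult.assoc)
  have mv_zero_mat: "0\<^sub>m n n *\<^sub>v x = 0\<^sub>v n" if "x \<in> carrier_vec n" for x :: "real vec"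
    using that by (intro eq_vecI) (auto simp: scalar_prod_def)
  have mv: "a *\<^sub>v x \<in> carrier_vec n" if "a \<in> poly_algebra M" for a x
    using P_dim(1)[OF that] by (intro carrier_vecI) (simp only: dim_mult_mat_vec)
  note mv_simps = add_mult_distrib_mat_vec[OF P P] mult_add_distrib_mat_vec[OF P]
    mult_minus_distrib_mat_vec[OF P mv mv] mult_mat_vec[OF P] mv_smult_mat mv_zero_mat
  have br_add: "(a + b) *\<^sub>v z - c *\<^sub>v (x + y) = (a *\<^sub>v z - c *\<^sub>v x) + (b *\<^sub>v z - c *\<^sub>v y)"
    if "a \<in> poly_algebra M" "b \<in> poly_algebra M" "c \<in> poly_algebra M"
      "x \<in> carrier_vec n" "y \<in> carrier_vec n" "z \<in> carrier_vec n" for a b c x y z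
    using that by (simp only: mv_simps, intro eq_vecI) (auto simp: P_dim simp del: index_mult_mat_vec)
  have br_add': "a *\<^sub>v (y + z) - (b + c) *\<^sub>v x = (a *\<^sub>v y - b *\<^sub>v x) + (a *\<^sub>v z - c *\<^sub>v x)"
    if "a \<in> poly_algebra M" "b \<in> poly_algebra M" "c \<in> poly_algebra M"
      "x \<in> carrier_vec n" "y \<in> carrier_vec n" "z \<in> carrier_vec n" for a b c x y z
    using that by (simp only: mv_simps, intro eq_vecI) (auto simp: P_dim simp del: index_mult_mat_vec)
  have br_smult: "(r \<cdot>\<^sub>m a) *\<^sub>v y - b *\<^sub>v (r \<cdot>\<^sub>v x) = r \<cdot>\<^sub>v (a *\<^sub>v y - b *\<^sub>v x)"
    and br_smult': "a *\<^sub>v (r \<cdot>\<^sub>v y) - (r \<cdot>\<^sub>m b) *\<^sub>v x = r \<cdot>\<^sub>v (a *\<^sub>v y - b *\<^sub>v x)"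
    if "a \<in> poly_algebra M" "b \<in> poly_algebra M" "x \<in> carrier_vec n" "y \<in> carrier_vec n" for a b r x y
    using that
    by (simp only: mv_simps, intro eq_vecI, auto simp: P_dim right_diff_distrib simp del: index_mult_mat_vec)+
  have br_jacobi: "(a *\<^sub>v (b *\<^sub>v z - c *\<^sub>v y) - 0\<^sub>m n n *\<^sub>v x) + (b *\<^sub>v (c *\<^sub>v x - a *\<^sub>v z) - 0\<^sub>m n n *\<^sub>v y)
      + (c *\<^sub>v (a *\<^sub>v y - b *\<^sub>v x) - 0\<^sub>m n n *\<^sub>v z) = 0\<^sub>v n"
    if "a \<in> poly_algebra M" "b \<in> poly_algebra M" "c \<in> poly_algebra M"
      "x \<in> carrier_vec n" "y \<in> carrier_vec n" "z \<in> carrier_vec n" for a b c x y z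
    using that P_comm[OF that(2,1,6)] P_comm[OF that(3,1,5)] P_comm[OF that(3,2,4)]
    by (simp only: mv_simps, intro eq_vecI) (auto simp: P_dim simp del: index_mult_mat_vec)
  from mod_G show ?thesis
  proof (intro real_lie_algebra.intro real_lie_algebra_axioms.intro)
    fix X Y Z and r :: real
    assume "X \<in> carrier (lie_G M)" "Y \<in> carrier (lie_G M)" "Z \<in> carrier (lie_G M)"
    then obtain a x b y c z where XYZ: "X = (a, x)" "Y = (b, y)" "Z = (c, z)"
      and abc: "a \<in> poly_algebra M" "b \<in> poly_algebra M" "c \<in> poly_algebra M"
      and xyz: "x \<in> carrier_vec n" "y \<in> carrier_vec n" "z \<in> carrier_vec n"
      by (auto simp: defs)
    note simps = XYZ defs br_add[OF abc xyz] br_add'[OF abc xyz]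
    show "bracket (lie_G M) (X \<oplus>\<^bsub>lie_G M\<^esub> Y) Z
        = bracket (lie_G M) X Z \<oplus>\<^bsub>lie_G M\<^esub> bracket (lie_G M) Y Z"
      by (simp add: simps)
    show "bracket (lie_G M) X (Y \<oplus>\<^bsub>lie_G M\<^esub> Z)
        = bracket (lie_G M) X Y \<oplus>\<^bsub>lie_G M\<^esub> bracket (lie_G M) X Z"
      by (simp add: simps)
    show "bracket (lie_G M) X (bracket (lie_G M) Y Z) \<oplus>\<^bsub>lie_G M\<^esub> bracket (lie_G M) Y (bracket (lie_G M) Z X)
        \<oplus>\<^bsub>lie_G M\<^esub> bracket (lie_G M) Z (bracket (lie_G M) X Y) = \<zero>\<^bsub>lie_G M\<^esub>"
      using br_jacobi[OF abc xyz] by (simp add: XYZ defs)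
  next
    fix X Y and r :: real
    assume "X \<in> carrier (lie_G M)" "Y \<in> carrier (lie_G M)"
    then obtain a x b y where XY: "X = (a, x)" "Y = (b, y)"
      and ab: "a \<in> poly_algebra M" "b \<in> poly_algebra M"
      and xy: "x \<in> carrier_vec n" "y \<in> carrier_vec n"
      by (auto simp: defs)
    show "bracket (lie_G M) X Y \<in> carrier (lie_G M)"
      using ab by (simp add: XY defs P_zero mv)
    show "bracket (lie_G M) (r \<odot>\<^bsub>lie_G M\<^esub> X) Y = r \<odot>\<^bsub>lie_G M\<^esub> bracket (lie_G M) X Y"
      by (simp add: XY defs br_smult[OF ab xy])
    show "bracket (lie_G M) X (r \<odot>\<^bsub>lie_G M\<^esub> Y) = r \<odot>\<^bsub>lie_G M\<^esub> bracket (lie_G M) X Y"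
      by (simp add: XY defs br_smult'[OF ab xy])
  next
    fix X assume "X \<in> carrier (lie_G M)"
    then show "bracket (lie_G M) X X = \<zero>\<^bsub>lie_G M\<^esub>"
      by (auto simp: defs P_dim)
  qed
qed

lemma real_lie_algebra_direct_sum:
  assumes L: "\<And>i. i \<in> I \<Longrightarrow> real_lie_algebra (L i)"
  shows "real_lie_algebra (lie_direct_sum I L)"
proof -
  let ?S = "lie_direct_sum I L"
  have M: "module (class_ring :: real ring) (L i)" if "i \<in> I" for i
    using L[OF that] by (rule real_lie_algebra.axioms)
  have G: "abelian_group (L i)" if "i \<in> I" for i
    using M[OF that] by (rule module.axioms)
  note ab = abelian_monoid.a_assoc[OF abelian_group.axioms(1)[OF G]]
    abelian_monoid.a_comm[OF abelian_group.axioms(1)[OF G]]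
    abelian_monoid.l_zero[OF abelian_group.axioms(1)[OF G]]
    abelian_monoid.r_zero[OF abelian_group.axioms(1)[OF G]]
    abelian_monoid.a_closed[OF abelian_group.axioms(1)[OF G]]
    abelian_monoid.zero_closed[OF abelian_group.axioms(1)[OF G]]
  note md = module.smult_closed[OF M] module.smult_l_distr[OF M] module.smult_r_distr[OF M]
    module.smult_assoc1[OF M] module.smult_one[OF M]
    module.smult_r_null[OF M]
  note br = real_lie_algebra.bracket_closed[OF L]
    real_lie_algebra.bracket_add_left[OF L] real_lie_algebra.bracket_add_right[OF L]
    real_lie_algebra.bracket_smult_left[OF L] real_lie_algebra.bracket_smult_right[OF L]
    real_lie_algebra.bracket_self[OF L] real_lie_algebra.jacobi[OF L]
  have br_zero: "bracket (L i) \<zero>\<^bsub>L i\<^esub> y = \<zero>\<^bsub>L i\<^esub>" if "i \<in> I" "y \<in> carrier (L i)" for i y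
    using br(4)[OF that(1) ab(6)[OF that(1)] that(2), of 0] that ab md(6) module.smult_l_null[OF M[OF that(1)]]
      br(1)[OF that(1) ab(6)[OF that(1)] that(2)] by simp
  have S_I: "x \<in> carrier ?S"
    if "x \<in> (\<Pi>\<^sub>E i\<in>I. carrier (L i))" "finite {i \<in> I. x i \<noteq> \<zero>\<^bsub>L i\<^esub>}" for x
    using that by (simp add: lie_direct_sum_def)
  have S_mem: "x i \<in> carrier (L i)" if "x \<in> carrier ?S" "i \<in> I" for x i
    using that by (auto simp: lie_direct_sum_def)
  have S_fin: "finite {i \<in> I. x i \<noteq> \<zero>\<^bsub>L i\<^esub>}" if "x \<in> carrier ?S" for x
    using that by (simp add: lie_direct_sum_def)
  have S_ext: "x = y" if "x \<in> carrier ?S" "y \<in> carrier ?S" "\<And>i. i \<in> I \<Longrightarrow> x i = y i" for x y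
    using that by (auto simp: lie_direct_sum_def intro: PiE_ext)
  have S_ops: "(x \<oplus>\<^bsub>?S\<^esub> y) i = x i \<oplus>\<^bsub>L i\<^esub> y i" "\<zero>\<^bsub>?S\<^esub> i = \<zero>\<^bsub>L i\<^esub>"
    "(c \<odot>\<^bsub>?S\<^esub> x) i = c \<odot>\<^bsub>L i\<^esub> x i" "bracket ?S x y i = bracket (L i) (x i) (y i)" if "i \<in> I" for x y c i
    using that by (simp_all add: lie_direct_sum_def)
  have S_zero: "\<zero>\<^bsub>?S\<^esub> \<in> carrier ?S"
    by (rule S_I) (auto simp: lie_direct_sum_def ab)
  have S_add: "x \<oplus>\<^bsub>?S\<^esub> y \<in> carrier ?S" if "x \<in> carrier ?S" "y \<in> carrier ?S" for x y
  proof (rule S_I)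
    show "x \<oplus>\<^bsub>?S\<^esub> y \<in> (\<Pi>\<^sub>E i\<in>I. carrier (L i))"
      using S_mem[OF that(1)] S_mem[OF that(2)] by (auto simp: lie_direct_sum_def ab)
    show "finite {i \<in> I. (x \<oplus>\<^bsub>?S\<^esub> y) i \<noteq> \<zero>\<^bsub>L i\<^esub>}"
      by (rule finite_subset[OF _ finite_UnI[OF S_fin[OF that(1)] S_fin[OF that(2)]]]) (auto simp: S_ops ab)
  qed
  have S_smult: "c \<odot>\<^bsub>?S\<^esub> x \<in> carrier ?S" if "x \<in> carrier ?S" for c x
  proof (rule S_I)
    show "c \<odot>\<^bsub>?S\<^esub> x \<in> (\<Pi>\<^sub>E i\<in>I. carrier (L i))"
      using S_mem[OF that] by (auto simp: lie_direct_sum_def md)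
    show "finite {i \<in> I. (c \<odot>\<^bsub>?S\<^esub> x) i \<noteq> \<zero>\<^bsub>L i\<^esub>}"
      by (rule finite_subset[OF _ S_fin[OF that]]) (auto simp: S_ops md)
  qed
  have S_bracket: "bracket ?S x y \<in> carrier ?S" if "x \<in> carrier ?S" "y \<in> carrier ?S" for x y
  proof (rule S_I)
    show "bracket ?S x y \<in> (\<Pi>\<^sub>E i\<in>I. carrier (L i))"
      using S_mem[OF that(1)] S_mem[OF that(2)] by (auto simp: lie_direct_sum_def br)
    show "finite {i \<in> I. bracket ?S x y i \<noteq> \<zero>\<^bsub>L i\<^esub>}"
      by (rule finite_subset[OF _ S_fin[OF that(1)]]) (auto simp: S_ops br_zero S_mem that)
  qed
  note S_closed = S_zero S_add S_smult S_bracket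
  have "abelian_group ?S"
  proof (rule abelian_groupI)
    fix x assume x: "x \<in> carrier ?S"
    have "- 1 \<odot>\<^bsub>L i\<^esub> u \<oplus>\<^bsub>L i\<^esub> u = \<zero>\<^bsub>L i\<^esub>" if "i \<in> I" "u \<in> carrier (L i)" for i u
      using md(2)[OF that(1), of "- 1" 1 u] that md(5) module.smult_l_null[OF M[OF that(1)]] by simp
    then show "\<exists>y\<in>carrier ?S. y \<oplus>\<^bsub>?S\<^esub> x = \<zero>\<^bsub>?S\<^esub>"
      using x by (intro bexI[of _ "- 1 \<odot>\<^bsub>?S\<^esub> x"] S_ext) (auto simp: S_closed S_ops S_mem)
  qed (auto simp: S_closed S_ops S_mem ab abelian_monoid.a_lcomm[OF abelian_group.axioms(1)[OF G]] intro!: S_ext)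
  then have "module (class_ring :: real ring) ?S"
    by (intro moduleI) (auto simp: class_cring.is_cring S_closed S_ops S_mem md[simplified] intro!: S_ext)
  then show ?thesis
    by (intro real_lie_algebra.intro real_lie_algebra_axioms.intro)
      (auto simp: S_closed S_ops S_mem br intro!: S_ext)
qed

lemma real_lie_algebra_lie_of_brackets:
  assumes "\<And>x y z. \<lbrakk>x \<in> carrier_vec d; y \<in> carrier_vec d; z \<in> carrier_vec d\<rbrakk> \<Longrightarrow>
    let B = bracket (lie_of_brackets d b) in B x (B y z) + B y (B z x) + B z (B x y) = 0\<^sub>v d"
  shows "real_lie_algebra (lie_of_brackets d b)"
proof -
  note defs = lie_of_brackets_def
  have "abelian_group (lie_of_brackets d b)"
  proof (rule abelian_groupI)
    fix x assume "x \<in> carrier (lie_of_brackets d b)"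
    then show "\<exists>y\<in>carrier (lie_of_brackets d b). y \<oplus>\<^bsub>lie_of_brackets d b\<^esub> x = \<zero>\<^bsub>lie_of_brackets d b\<^esub>"
      by (intro bexI[of _ "- 1 \<cdot>\<^sub>v x"]) (auto simp: defs intro!: eq_vecI)
  qed (auto simp: defs intro!: eq_vecI)
  then have "module (class_ring :: real ring) (lie_of_brackets d b)"
    by (intro moduleI) (auto simp: defs class_cring.is_cring algebra_simps intro!: eq_vecI)
  moreover have "bracket (lie_of_brackets d b) x (bracket (lie_of_brackets d b) y z) + bracket (lie_of_brackets d b) y (bracket (lie_of_brackets d b) z x) +
      bracket (lie_of_brackets d b) z (bracket (lie_of_brackets d b) x y) = 0\<^sub>v d"
    if "x \<in> carrier_vec d" "y \<in> carrier_vec d" "z \<in> carrier_vec d" for x y z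
    using assms[OF that] by (simp add: Let_def)
  moreover have "bracket (lie_of_brackets d b) (x + y) z = bracket (lie_of_brackets d b) x z + bracket (lie_of_brackets d b) y z"
    "bracket (lie_of_brackets d b) z (x + y) = bracket (lie_of_brackets d b) z x + bracket (lie_of_brackets d b) z y"
    "bracket (lie_of_brackets d b) (c \<cdot>\<^sub>v x) z = c \<cdot>\<^sub>v bracket (lie_of_brackets d b) x z"
    "bracket (lie_of_brackets d b) z (c \<cdot>\<^sub>v x) = c \<cdot>\<^sub>v bracket (lie_of_brackets d b) z x"
    if xy: "x \<in> carrier_vec d" "y \<in> carrier_vec d" for x y z c
  proof -
    have ix: "(x + y) $ i = x $ i + y $ i" "(c \<cdot>\<^sub>v x) $ i = c * x $ i" if "i < d" for i
      using that xy by simp_all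
    have s: "(((x + y) $ i * z $ j - (x + y) $ j * z $ i) * b i j $ l) =
        ((x $ i * z $ j - x $ j * z $ i) * b i j $ l) + ((y $ i * z $ j - y $ j * z $ i) * b i j $ l)"
      "((z $ i * (x + y) $ j - z $ j * (x + y) $ i) * b i j $ l) =
        ((z $ i * x $ j - z $ j * x $ i) * b i j $ l) + ((z $ i * y $ j - z $ j * y $ i) * b i j $ l)"
      "(((c \<cdot>\<^sub>v x) $ i * z $ j - (c \<cdot>\<^sub>v x) $ j * z $ i) * b i j $ l) =
        c * ((x $ i * z $ j - x $ j * z $ i) * b i j $ l)"
      "((z $ i * (c \<cdot>\<^sub>v x) $ j - z $ j * (c \<cdot>\<^sub>v x) $ i) * b i j $ l) =
        c * ((z $ i * x $ j - z $ j * x $ i) * b i j $ l)"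
      if "j < d" "i < j" for i j l
      using that less_trans[OF that(2,1)] by (simp_all only: ix) (simp_all add: algebra_simps)
    have br: "bracket (lie_of_brackets d b) u v $ l = (\<Sum>j<d. \<Sum>i<j. (u $ i * v $ j - u $ j * v $ i) * b i j $ l)"
      "dim_vec (bracket (lie_of_brackets d b) u v) = d" if "l < d" for u v l
      using that by (simp_all add: defs)
    have dim: "dim_vec (bracket (lie_of_brackets d b) u v) = d" for u v
      by (simp add: defs)
    show "bracket (lie_of_brackets d b) (x + y) z = bracket (lie_of_brackets d b) x z + bracket (lie_of_brackets d b) y z"
      by (rule eq_vecI) (simp_all add: dim br s sum.distrib del: index_add_vec(1), simp_all add: dim br)
    show "bracket (lie_of_brackets d b) z (x + y) = bracket (lie_of_brackets d b) z x + bracket (lie_of_brackets d b) z y"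
      by (rule eq_vecI) (simp_all add: dim br s sum.distrib del: index_add_vec(1), simp_all add: dim br)
    show "bracket (lie_of_brackets d b) (c \<cdot>\<^sub>v x) z = c \<cdot>\<^sub>v bracket (lie_of_brackets d b) x z"
      by (rule eq_vecI) (simp_all add: dim br s sum_distrib_left del: index_smult_vec(1), simp_all add: dim br sum_distrib_left)
    show "bracket (lie_of_brackets d b) z (c \<cdot>\<^sub>v x) = c \<cdot>\<^sub>v bracket (lie_of_brackets d b) z x"
      by (rule eq_vecI) (simp_all add: dim br s sum_distrib_left del: index_smult_vec(1), simp_all add: dim br sum_distrib_left)
  qed
  moreover have "bracket (lie_of_brackets d b) x x = 0\<^sub>v d" for x
    by (intro eq_vecI) (simp_all add: defs)
  moreover have "bracket (lie_of_brackets d b) x y \<in> carrier_vec d" for x y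
    by (simp add: defs)
  moreover have "carrier (lie_of_brackets d b) = carrier_vec d" "add (lie_of_brackets d b) = (+)"
    "zero (lie_of_brackets d b) = 0\<^sub>v d" "smult (lie_of_brackets d b) = (\<cdot>\<^sub>v)"
    by (simp_all add: defs)
  ultimately show ?thesis
    by (intro real_lie_algebra.intro real_lie_algebra_axioms.intro) simp_all
qed

lemma real_lie_algebra_aff_R: "real_lie_algebra aff_R"
  unfolding aff_R_def
  by (rule real_lie_algebra_lie_of_brackets)
    (auto simp: lie_of_brackets_def numeral_eq_Suc lessThan_Suc less_Suc_eq algebra_simps intro!: eq_vecI)

lemma real_lie_algebra_aff_C: "real_lie_algebra aff_C"
  unfolding aff_C_def
  by (rule real_lie_algebra_lie_of_brackets)
    (auto simp: lie_of_brackets_def numeral_eq_Suc lessThan_Suc less_Suc_eq algebra_simps intro!: eq_vecI)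

end

(*
  For a polynomial f call (R[X] / f) semidirect (R[X] / f) the Lie algebra with bracket
  [(a, x), (b, y)] = (0, a y - b x).  A nonderogatory matrix has a cyclic vector, so G_M is this
  Lie algebra for f the characteristic polynomial of M.  It therefore depends only on f: an affine
  change of the variable identifies the algebras of (X - r)^k and X^k, and those of
  ((X - a)^2 + b^2)^m and (X^2 + 1)^m, and the Chinese remainder theorem turns a factorisation of f
  into coprime factors into a direct sum.  The model algebras are recognised in the same way,
  by exhibiting a cyclic vector.
*)
theory Submission
  imports Defs "HOL-Computational_Algebra.Field_as_Ring" "HOL-Computational_Algebra.Polynomial_Factorial"
begin

section \<open>Presentations by pairs of polynomials\<close>

text \<open>The bracket is built from ring operations of R[X]/(f) alone and never refers to the
  class of X. A substitution that induces a ring isomorphism of two such quotients therefore carries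
  one algebra to the other, even when the matrices behind them are not similar. This is why the
  eigenvalues themselves disappear and only their multiplicities and their type, real or nonreal,
  survive.

  Both types are treated alike: the prime factors of the characteristic polynomial are indexed by
  complex numbers w, one from each conjugate pair, and divisibility by the factor of w means
  vanishing at w.

  The delicate point is the cyclic vector. Equality of minimal and characteristic polynomial says
  only that lowering the exponent of one prime factor gives a polynomial that does not vanish at M.
  The vectors witnessing this differ from factor to factor; cut down to their primary parts they
  have coprime annihilators, and their sum is cyclic.\<close>

text \<open>
  Says that \<open>L\<close> is a copy of \<open>\<real>[X]/(f) \<ltimes> \<real>[X]/(f)\<close>; the map \<open>\<phi>\<close> is defined on all pairs of
  polynomials, which avoids forming the quotient.
\<close>
locale presentation =
  fixes f :: "real poly" and L :: "'a lie_algebra" and \<phi> :: "real poly \<Rightarrow> real poly \<Rightarrow> 'a"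
  assumes closed: "\<phi> a x \<in> carrier L"
    and surj: "t \<in> carrier L \<Longrightarrow> \<exists>a x. t = \<phi> a x"
    and eq_iff: "\<phi> a x = \<phi> b y \<longleftrightarrow> f dvd a - b \<and> f dvd x - y"
    and add: "\<phi> a x \<oplus>\<^bsub>L\<^esub> \<phi> b y = \<phi> (a + b) (x + y)"
    and smult: "c \<odot>\<^bsub>L\<^esub> \<phi> a x = \<phi> (Polynomial.smult c a) (Polynomial.smult c x)"
    and bracket: "bracket L (\<phi> a x) (\<phi> b y) = \<phi> 0 (a * y - b * x)"

definition presents :: "real poly \<Rightarrow> 'a lie_algebra \<Rightarrow> bool" where
  "presents f L \<longleftrightarrow> (\<exists>\<phi>. presentation f L \<phi>)"

text \<open>Both presentations have the same fibres, since \<open>eq_iff\<close> depends on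
  \<open>f\<close> alone. So sending \<open>\<phi> a x\<close> to \<open>\<psi> a x\<close> is well
  defined and injective; on the carrier, \<open>SOME\<close> picks the only possible value.\<close>

lemma presents_imp_lie_isomorphic:
  assumes "presents f L" "presents f L'"
  shows "L \<cong>\<^sub>L L'"
proof -
  obtain \<phi> where "presentation f L \<phi>" using assms(1) by (auto simp: presents_def)
  then interpret \<phi>: presentation f L \<phi> .
  obtain \<psi> where "presentation f L' \<psi>" using assms(2) by (auto simp: presents_def)
  then interpret \<psi>: presentation f L' \<psi> .
  define F where "F t = (SOME s. \<exists>a x. t = \<phi> a x \<and> s = \<psi> a x)" for t
  have F: "F (\<phi> a x) = \<psi> a x" for a x
    unfolding F_def
    by (rule some_equality, blast) (metis \<phi>.eq_iff \<psi>.eq_iff)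
  have "F \<in> LinearCombinations.module_hom class_ring L L'"
    unfolding LinearCombinations.module_hom_def
    by (auto dest!: \<phi>.surj simp: F \<phi>.add \<phi>.smult \<psi>.closed \<psi>.add \<psi>.smult)
  moreover have "bij_betw F (carrier L) (carrier L')"
  proof (rule bij_betw_imageI)
    show "inj_on F (carrier L)"
    proof (rule inj_onI)
      fix s t assume st: "s \<in> carrier L" "t \<in> carrier L" "F s = F t"
      from \<phi>.surj[OF st(1)] \<phi>.surj[OF st(2)] obtain a x b y where "s = \<phi> a x" "t = \<phi> b y" by blast
      with st(3) show "s = t" by (simp add: F \<phi>.eq_iff \<psi>.eq_iff)
    qed
    show "F ` carrier L = carrier L'"
    proof (rule equalityI; rule subsetI)
      fix s assume "s \<in> F ` carrier L"
      then show "s \<in> carrier L'" using \<phi>.surj \<psi>.closed F by (metis imageE)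
    next
      fix s assume "s \<in> carrier L'"
      then show "s \<in> F ` carrier L" using \<psi>.surj \<phi>.closed F by (metis image_eqI)
    qed
  qed
  moreover have "F (bracket L s t) = bracket L' (F s) (F t)"
    if st: "s \<in> carrier L" "t \<in> carrier L" for s t
  proof -
    from \<phi>.surj[OF st(1)] \<phi>.surj[OF st(2)] obtain a x b y where "s = \<phi> a x" "t = \<phi> b y" by blast
    then show ?thesis by (simp add: F \<phi>.bracket \<psi>.bracket)
  qed
  ultimately have "F \<in> lie_iso L L'" by (simp add: lie_iso_def)
  then show ?thesis by (auto simp: lie_isomorphic_def)
qed

lemma presents_cong_dvd:
  assumes "presents f L" "f dvd g" "g dvd f"
  shows "presents g L"
proof -
  have "f dvd h \<longleftrightarrow> g dvd h" for h using assms(2,3) dvd_trans by blast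
  with assms(1) show ?thesis by (simp add: presents_def presentation_def)
qed

text \<open>The substitution X -> c X + d is an automorphism of the polynomial ring that takes the
  ideal of \<open>f\<close> to that of \<open>pcompose f [:d, c:]\<close>. The new presentation
  first applies the inverse substitution \<open>?r\<close>; the bracket survives because it consists
  of ring operations.\<close>

lemma presents_pcompose_linear:
  assumes "presents f L" "c \<noteq> 0"
  shows "presents (pcompose f [:d, c:]) L"
proof -
  obtain \<phi> where "presentation f L \<phi>" using assms(1) by (auto simp: presents_def)
  then interpret presentation f L \<phi> .
  let ?l = "[:d, c:]" and ?r = "[:- d / c, 1 / c:]"
  have lr: "pcompose ?l ?r = [:0, 1:]" and rl: "pcompose ?r ?l = [:0, 1:]"
    using assms(2) by (simp_all add: pcompose_pCons field_simps)
  have inv: "pcompose (pcompose g ?l) ?r = g" "pcompose (pcompose g ?r) ?l = g" for g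
    by (simp_all only: pcompose_assoc[symmetric] lr rl pcompose_idR)
  have dvd: "f dvd pcompose g ?r \<longleftrightarrow> pcompose f ?l dvd g" for g
  proof
    assume "f dvd pcompose g ?r"
    then obtain h where "pcompose g ?r = f * h" ..
    then have "g = pcompose f ?l * pcompose h ?l"
      by (metis inv(2) pcompose_mult)
    then show "pcompose f ?l dvd g" by simp
  next
    assume "pcompose f ?l dvd g"
    then obtain h where "g = pcompose f ?l * h" ..
    then have "pcompose g ?r = f * pcompose h ?r" by (simp only: pcompose_mult inv)
    then show "f dvd pcompose g ?r" by simp
  qed
  have "presentation (pcompose f ?l) L (\<lambda>a x. \<phi> (pcompose a ?r) (pcompose x ?r))"
  proof
    fix t assume "t \<in> carrier L"
    then obtain a x where "t = \<phi> a x" using surj by blast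
    then have "t = \<phi> (pcompose (pcompose a ?l) ?r) (pcompose (pcompose x ?l) ?r)" by (simp only: inv)
    then show "\<exists>a x. t = \<phi> (pcompose a ?r) (pcompose x ?r)" by blast
  next
    fix a x b y
    show "\<phi> (pcompose a ?r) (pcompose x ?r) = \<phi> (pcompose b ?r) (pcompose y ?r) \<longleftrightarrow>
        pcompose f ?l dvd a - b \<and> pcompose f ?l dvd x - y"
      by (simp only: eq_iff dvd flip: pcompose_diff)
  qed (simp_all only: closed add smult bracket pcompose_0 flip: pcompose_add pcompose_smult pcompose_diff pcompose_mult)
  then show ?thesis by (auto simp: presents_def)
qed

section \<open>Chinese remaindering and direct sums\<close>

lemma prod_dvd_if_coprime:
  fixes f :: "'i \<Rightarrow> 'a::semiring_gcd"
  assumes "finite I" "\<And>i. i \<in> I \<Longrightarrow> f i dvd g"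
    and "\<And>i j. i \<in> I \<Longrightarrow> j \<in> I \<Longrightarrow> i \<noteq> j \<Longrightarrow> coprime (f i) (f j)"
  shows "prod f I dvd g"
  using assms
proof (induction I rule: finite_induct)
  case (insert i I)
  have "coprime (f i) (prod f I)"
    by (rule prod_coprime_right) (use insert in auto)
  moreover have "prod f I dvd g" by (rule insert.IH) (use insert.prems in auto)
  ultimately show ?case using insert by (simp add: divides_mult)
qed simp

lemma coprime_bezout:
  fixes p q :: "real poly"
  assumes "coprime p q"
  obtains u v where "u * p + v * q = 1"
  using assms bezout_coefficients_fst_snd[of p q] that by (metis coprime_iff_gcd_eq_1)

lemma chinese_remainder_poly:
  fixes f :: "'i \<Rightarrow> real poly"
  assumes "finite I" "\<And>i j. i \<in> I \<Longrightarrow> j \<in> I \<Longrightarrow> i \<noteq> j \<Longrightarrow> coprime (f i) (f j)"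
  shows "\<exists>a. \<forall>i\<in>I. f i dvd a - b i"
  using assms
proof (induction I rule: finite_induct)
  case (insert i I)
  then obtain a where a: "\<forall>j\<in>I. f j dvd a - b j" by blast
  have "coprime (f i) (prod f I)"
    by (rule prod_coprime_right) (use insert in auto)
  then obtain u v where uv: "u * f i + v * prod f I = 1" by (rule coprime_bezout)
  \<comment> \<open>\<open>v * prod f I\<close> is 1 modulo \<open>f i\<close> and 0 modulo every
    \<open>f j\<close> with \<open>j\<close> in \<open>I\<close>, so the correction changes the
    residue at \<open>i\<close> only.\<close>
  define a' where "a' = a + v * prod f I * (b i - a)"
  have "a' - b i = (v * prod f I - 1) * (b i - a)" by (simp add: a'_def algebra_simps)
  also have "v * prod f I - 1 = f i * (- u)" using uv by (simp add: algebra_simps)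
  finally have "f i dvd a' - b i" by (simp add: mult.assoc)
  moreover have "f j dvd a' - b j" if "j \<in> I" for j
  proof -
    have "f j dvd prod f I" using dvd_prodI[OF insert.hyps(1) that] .
    then have "f j dvd (a - b j) + v * prod f I * (b i - a)"
      using a that by (intro dvd_add) auto
    then show ?thesis by (simp add: a'_def algebra_simps)
  qed
  ultimately show ?case by auto
qed simp

text \<open>Every component receives the same pair of polynomials. Coprimality turns divisibility by
  all \<open>f i\<close> into divisibility by the product, and the Chinese remainder theorem, used
  once for the matrix part and once for the vector part, gives surjectivity.\<close>

lemma presents_direct_sum:
  assumes I: "finite I" and L: "\<And>i. i \<in> I \<Longrightarrow> presents (f i) (L i)"
    and cop: "\<And>i j. i \<in> I \<Longrightarrow> j \<in> I \<Longrightarrow> i \<noteq> j \<Longrightarrow> coprime (f i) (f j)"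
  shows "presents (prod f I) (lie_direct_sum I L)"
proof -
  have "\<forall>i\<in>I. \<exists>\<phi>. presentation (f i) (L i) \<phi>" using L by (simp add: presents_def)
  then obtain \<phi> where \<phi>: "\<And>i. i \<in> I \<Longrightarrow> presentation (f i) (L i) (\<phi> i)"
    unfolding bchoice_iff by blast
  note simps = presentation.closed[OF \<phi>] presentation.eq_iff[OF \<phi>] presentation.add[OF \<phi>]
    presentation.smult[OF \<phi>] presentation.bracket[OF \<phi>]
  have dvd: "prod f I dvd g \<longleftrightarrow> (\<forall>i\<in>I. f i dvd g)" for g
    using prod_dvd_if_coprime[OF I, of f g] cop dvd_trans[of _ "prod f I" g] dvd_prodI[OF I, of _ f]
    by blast
  let ?\<phi> = "\<lambda>a x. \<lambda>i\<in>I. \<phi> i a x"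
  have "presentation (prod f I) (lie_direct_sum I L) ?\<phi>"
  proof
    fix a x
    show "?\<phi> a x \<in> carrier (lie_direct_sum I L)"
      using I simps(1) by (auto simp: lie_direct_sum_def)
  next
    fix t assume "t \<in> carrier (lie_direct_sum I L)"
    then have t: "t \<in> extensional I" "\<And>i. i \<in> I \<Longrightarrow> t i \<in> carrier (L i)"
      by (auto simp: lie_direct_sum_def PiE_def)
    then have "\<forall>i\<in>I. \<exists>a x. t i = \<phi> i a x" using presentation.surj[OF \<phi>] by blast
    then obtain a x where ax: "\<And>i. i \<in> I \<Longrightarrow> t i = \<phi> i (a i) (x i)" by metis
    obtain a' where a': "\<forall>i\<in>I. f i dvd a' - a i" using chinese_remainder_poly[of I f, OF I cop] by blast
    obtain x' where x': "\<forall>i\<in>I. f i dvd x' - x i" using chinese_remainder_poly[of I f, OF I cop] by blast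
    have "t = ?\<phi> a' x'"
      using t(1) a' x' by (intro extensionalityI[of _ I]) (auto simp: ax simps(2) dvd_diff_commute)
    then show "\<exists>a x. t = ?\<phi> a x" by blast
  next
    fix a x b y
    have "?\<phi> a x = ?\<phi> b y \<longleftrightarrow> (\<forall>i\<in>I. \<phi> i a x = \<phi> i b y)"
      by (auto simp: fun_eq_iff restrict_def)
    then show "?\<phi> a x = ?\<phi> b y \<longleftrightarrow> prod f I dvd a - b \<and> prod f I dvd x - y"
      by (auto simp: dvd simps(2))
  qed (auto simp: lie_direct_sum_def fun_eq_iff restrict_def simps(3-5))
  then show ?thesis by (auto simp: presents_def)
qed

section \<open>Vectors as a module over the polynomial ring\<close>

text \<open>Horner's rule; it opens matrix polynomials to induction over
  \<open>pCons\<close>.\<close>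

lemma poly_mat_pCons:
  assumes A: "A \<in> carrier_mat n n"
  shows "poly_mat (pCons a f) A = a \<cdot>\<^sub>m 1\<^sub>m n + A * poly_mat f A"
proof (rule eq_matI)
  fix i j assume "i < dim_row (a \<cdot>\<^sub>m 1\<^sub>m n + A * poly_mat f A)"
    "j < dim_col (a \<cdot>\<^sub>m 1\<^sub>m n + A * poly_mat f A)"
  then have ij: "i < n" "j < n" using A by auto
  let ?d = "degree f"
  \<comment> \<open>Matrix powers grow by a factor on the right, while Horner's rule needs the new
    factor on the left.\<close>
  have pow: "A ^\<^sub>m Suc k = A * A ^\<^sub>m k" for k
    using pow_mat_add_exp[OF A, of 1 k] A by simp
  have "degree (pCons a f) \<le> Suc ?d" by (rule degree_pCons_le)
  then have "poly_mat (pCons a f) A $$ (i, j) = (\<Sum>k\<le>Suc ?d. coeff (pCons a f) k * (A ^\<^sub>m k) $$ (i, j))"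
    using ij A by (intro poly_mat_index) auto
  also have "\<dots> = a * 1\<^sub>m n $$ (i, j) + (\<Sum>k\<le>?d. coeff f k * (A ^\<^sub>m Suc k) $$ (i, j))"
    using A by (subst sum.atMost_Suc_shift) (simp del: pow_mat.simps(2))
  also have "(\<Sum>k\<le>?d. coeff f k * (A ^\<^sub>m Suc k) $$ (i, j)) =
      (\<Sum>k\<le>?d. \<Sum>r<n. coeff f k * (A $$ (i, r) * (A ^\<^sub>m k) $$ (r, j)))"
    unfolding pow using ij A by (simp add: scalar_prod_def atLeast0LessThan sum_distrib_left)
  also have "\<dots> = (\<Sum>r<n. A $$ (i, r) * poly_mat f A $$ (r, j))"
    using ij A by (subst sum.swap) (simp add: poly_mat_index[OF _ _ order_refl] sum_distrib_left algebra_simps)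
  also have "\<dots> = (A * poly_mat f A) $$ (i, j)"
    using ij A by (simp add: scalar_prod_def atLeast0LessThan)
  finally show "poly_mat (pCons a f) A $$ (i, j) = (a \<cdot>\<^sub>m 1\<^sub>m n + A * poly_mat f A) $$ (i, j)"
    using ij A by simp
qed (use A in auto)

lemma mat_eq_zero_iff_mult_vec:
  fixes B :: "'a::comm_ring_1 mat"
  assumes "B \<in> carrier_mat n m"
  shows "B = 0\<^sub>m n m \<longleftrightarrow> (\<forall>v\<in>carrier_vec m. B *\<^sub>v v = 0\<^sub>v n)"
proof
  assume *: "\<forall>v\<in>carrier_vec m. B *\<^sub>v v = 0\<^sub>v n"
  show "B = 0\<^sub>m n m"
  proof (rule eq_matI)
    fix i j assume ij: "i < dim_row (0\<^sub>m n m :: 'a mat)" "j < dim_col (0\<^sub>m n m :: 'a mat)"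
    then have "(B *\<^sub>v unit_vec m j) $ i = B $$ (i, j)"
      using assms by (simp add: scalar_prod_right_unit)
    then show "B $$ (i, j) = 0\<^sub>m n m $$ (i, j)" using * ij by simp
  qed (use assms in auto)
qed (use assms in \<open>auto intro!: eq_vecI simp: scalar_prod_def\<close>)

lemma zero_smult_add_vec:
  fixes u v :: "'a::comm_ring_1 vec"
  assumes "v \<in> carrier_vec n" "u \<in> carrier_vec n"
  shows "0 \<cdot>\<^sub>v v + u = u"
  using assms by (intro eq_vecI) auto

locale poly_action =
  fixes A :: "real mat" and n :: nat
  assumes A: "A \<in> carrier_mat n n"
begin

text \<open>The R[X]-module structure on R^n in which X acts as \<open>A\<close>.\<close>

definition act :: "real poly \<Rightarrow> real vec \<Rightarrow> real vec" where
  "act g v = poly_mat g A *\<^sub>v v"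

lemma dim_A [simp]: "dim_row A = n" "dim_col A = n"
  using A by auto

lemma poly_mat_closed: "poly_mat g A \<in> carrier_mat n n"
  by auto

lemma act_closed [simp]: "act g v \<in> carrier_vec n"
  by (auto simp: act_def intro!: carrier_vecI)

lemma dim_act [simp]: "dim_vec (act g v) = n"
  by (simp add: act_def)

lemma act_add: "v \<in> carrier_vec n \<Longrightarrow> act (g + h) v = act g v + act h v"
  by (simp add: act_def poly_mat_add add_mult_distrib_mat_vec[OF poly_mat_closed poly_mat_closed])

lemma act_add_vec: "u \<in> carrier_vec n \<Longrightarrow> v \<in> carrier_vec n \<Longrightarrow> act g (u + v) = act g u + act g v"
  by (simp add: act_def mult_add_distrib_mat_vec[OF poly_mat_closed])

lemma act_smult: "v \<in> carrier_vec n \<Longrightarrow> act (Polynomial.smult c g) v = c \<cdot>\<^sub>v act g v"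
  by (intro eq_vecI) (auto simp: act_def poly_mat_smult)

lemma act_0 [simp]: "v \<in> carrier_vec n \<Longrightarrow> act 0 v = 0\<^sub>v n"
  using act_smult[of v 0 0] by (simp add: vec_eq_iff)

lemma act_zero_vec [simp]: "act g (0\<^sub>v n) = 0\<^sub>v n"
  by (intro eq_vecI) (simp_all add: act_def scalar_prod_right_zero[of _ n] carrier_vecI)

lemma act_diff: "v \<in> carrier_vec n \<Longrightarrow> act (g - h) v = act g v - act h v"
  using act_add[of v "g - h" h] by (auto intro!: eq_vecI)

lemma act_pCons: "v \<in> carrier_vec n \<Longrightarrow> act (pCons a g) v = a \<cdot>\<^sub>v v + A *\<^sub>v act g v"
  unfolding act_def poly_mat_pCons[OF A]
  by (subst add_mult_distrib_mat_vec[of _ n n])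
    (auto simp: A intro!: eq_vecI simp: assoc_mult_mat_vec[OF A poly_mat_closed])

lemma act_1 [simp]: "v \<in> carrier_vec n \<Longrightarrow> act 1 v = v"
  using A by (simp add: one_pCons act_pCons) (auto intro!: eq_vecI)

lemma act_mult: "v \<in> carrier_vec n \<Longrightarrow> act (g * h) v = act g (act h v)"
proof (induction g)
  case (pCons a g)
  have "act (pCons a g * h) v = a \<cdot>\<^sub>v act h v + (0 \<cdot>\<^sub>v v + A *\<^sub>v act (g * h) v)"
    using pCons.prems by (simp add: act_add act_smult act_pCons)
  also have "\<dots> = act (pCons a g) (act h v)"
    using pCons A by (simp add: zero_smult_add_vec[of _ n] act_pCons mult_mat_vec_carrier[of _ n n])
  finally show ?case .
qed simp

lemma act_dvd:
  assumes "f dvd g" "act f v = 0\<^sub>v n" "v \<in> carrier_vec n"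
  shows "act g v = 0\<^sub>v n"
  using assms by (auto simp: act_mult mult.commute[of f] elim!: dvdE)

section \<open>Annihilator ideals of vectors and cyclic vectors\<close>

definition has_annihilator :: "real vec \<Rightarrow> real poly \<Rightarrow> bool" where
  "has_annihilator v f \<longleftrightarrow> v \<in> carrier_vec n \<and> (\<forall>g. act g v = 0\<^sub>v n \<longleftrightarrow> f dvd g)"

lemma annihilated_coprime:
  assumes "coprime f g" "act f v = 0\<^sub>v n" "act g v = 0\<^sub>v n" "v \<in> carrier_vec n"
  shows "v = 0\<^sub>v n"
proof -
  obtain p q where "p * f + q * g = 1" using assms(1) by (rule coprime_bezout)
  then have "v = act (p * f + q * g) v" using assms by simp
  also have "\<dots> = 0\<^sub>v n" using assms by (simp add: act_add act_mult)
  finally show ?thesis .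
qed

text \<open>The induction strips one factor \<open>p\<close> at a time. If \<open>g\<close> were
  coprime to the power of \<open>p\<close> that kills \<open>v\<close>, Bezout would give v = 0;
  hence \<open>g = h * p\<close>, and \<open>h\<close> annihilates \<open>act p v\<close>, whose
  exponent is smaller by one.\<close>

lemma prime_power_dvd_if_annihilates:
  assumes p: "prime_elem p" and "v \<in> carrier_vec n"
    and "act (p ^ Suc e) v = 0\<^sub>v n" "act (p ^ e) v \<noteq> 0\<^sub>v n" "act g v = 0\<^sub>v n"
  shows "p ^ Suc e dvd g"
  using assms(2-)
proof (induction e arbitrary: v g)
  case (0 v g)
  then have "\<not> coprime p g" using annihilated_coprime[of p g v] by auto
  then show ?case using prime_elem_imp_coprime[OF p] by auto
next
  case (Suc e v g)
  have "\<not> coprime g (p ^ Suc (Suc e))"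
    using Suc.prems annihilated_coprime[of g "p ^ Suc (Suc e)" v] by (auto simp del: power_Suc)
  then have "p dvd g" using prime_elem_imp_power_coprime[OF p] by blast
  then obtain h where h: "g = h * p" by (metis dvdE mult.commute)
  have "p ^ Suc e dvd h"
  proof (rule Suc.IH[of "act p v"])
    show "act (p ^ Suc e) (act p v) = 0\<^sub>v n" "act (p ^ e) (act p v) \<noteq> 0\<^sub>v n" "act h (act p v) = 0\<^sub>v n"
      using Suc.prems by (simp_all add: h mult_ac flip: act_mult)
  qed simp
  then show ?case by (simp add: h mult.commute)
qed

lemma has_annihilator_prime_power:
  assumes "prime_elem p" "v \<in> carrier_vec n"
    and "act (p ^ Suc e) v = 0\<^sub>v n" "act (p ^ e) v \<noteq> 0\<^sub>v n"
  shows "has_annihilator v (p ^ Suc e)"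
  unfolding has_annihilator_def
  using prime_power_dvd_if_annihilates[OF assms] act_dvd[OF _ assms(3,2)] assms(2) by blast

text \<open>If \<open>h\<close> kills \<open>u + v\<close>, then \<open>g * h\<close> kills
  \<open>u + v\<close> and \<open>v\<close>, hence also \<open>u\<close>; so \<open>f\<close>
  divides \<open>g * h\<close> and, by coprimality, \<open>h\<close>. The same holds with the roles
  exchanged.\<close>

lemma has_annihilator_add:
  assumes "has_annihilator u f" "has_annihilator v g" "coprime f g"
  shows "has_annihilator (u + v) (f * g)"
proof -
  have uv: "u \<in> carrier_vec n" "v \<in> carrier_vec n" and
    u: "\<And>h. act h u = 0\<^sub>v n \<longleftrightarrow> f dvd h" and v: "\<And>h. act h v = 0\<^sub>v n \<longleftrightarrow> g dvd h"
    using assms by (auto simp: has_annihilator_def)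
  have "act h (u + v) = 0\<^sub>v n \<longleftrightarrow> f * g dvd h" for h
  proof
    assume h: "act h (u + v) = 0\<^sub>v n"
    have *: "act (r * h) u + act (r * h) v = 0\<^sub>v n" for r
      using uv h by (simp add: act_mult flip: act_add_vec)
    have "act (g * h) v = 0\<^sub>v n" "act (f * h) u = 0\<^sub>v n" using u v by auto
    then have "act (g * h) u = 0\<^sub>v n" "act (f * h) v = 0\<^sub>v n" using *[of g] *[of f] by auto
    then have "f dvd g * h" "g dvd f * h" using u v by auto
    then have "f dvd h" "g dvd h"
      using assms(3) by (auto simp: coprime_dvd_mult_right_iff coprime_commute)
    then show "f * g dvd h" using assms(3) by (simp add: divides_mult)
  next
    assume "f * g dvd h"
    then have "f dvd h" "g dvd h" by (auto dest: dvd_mult_left dvd_mult_right)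
    then show "act h (u + v) = 0\<^sub>v n" using uv by (simp add: act_add_vec u[THEN iffD2] v[THEN iffD2])
  qed
  then show ?thesis using uv by (simp add: has_annihilator_def)
qed

lemma has_annihilator_prod:
  assumes "finite I" "\<And>i. i \<in> I \<Longrightarrow> \<exists>v. has_annihilator v (f i)"
    and "\<And>i j. i \<in> I \<Longrightarrow> j \<in> I \<Longrightarrow> i \<noteq> j \<Longrightarrow> coprime (f i) (f j)"
  shows "\<exists>v. has_annihilator v (prod f I)"
  using assms
proof (induction I rule: finite_induct)
  case empty
  have "has_annihilator (0\<^sub>v n) 1" by (simp add: has_annihilator_def)
  then show ?case by auto
next
  case (insert i I)
  then obtain u where u: "has_annihilator u (f i)" by blast
  have "\<exists>v. has_annihilator v (prod f I)" by (rule insert.IH) (use insert.prems in auto)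
  then obtain v where v: "has_annihilator v (prod f I)" by blast
  have "coprime (f i) (prod f I)"
    by (rule prod_coprime_right) (use insert in auto)
  then have "has_annihilator (u + v) (f i * prod f I)" by (rule has_annihilator_add[OF u v])
  then show ?case using insert.hyps by auto
qed

text \<open>Lowering the exponent of \<open>p i\<close> by one gives a nonzero polynomial of degree
  below that of the minimal polynomial, so it does not kill \<open>A\<close> and some vector
  \<open>v\<close> survives it. Applying the cofactor \<open>h\<close> to \<open>v\<close> leaves a
  vector with annihilator exactly \<open>p i ^ Suc d\<close>; these vectors are then combined over
  all \<open>i\<close>.\<close>

lemma nonderogatory_imp_cyclic:
  assumes "nonderogatory A" "finite I"
    and prime: "\<And>i. i \<in> I \<Longrightarrow> prime_elem (p i)" and e: "\<And>i. i \<in> I \<Longrightarrow> e i > 0"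
    and cop: "\<And>i j. i \<in> I \<Longrightarrow> j \<in> I \<Longrightarrow> i \<noteq> j \<Longrightarrow> coprime (p i) (p j)"
    and prod: "char_poly A = (\<Prod>i\<in>I. p i ^ e i)"
  shows "\<exists>v. has_annihilator v (char_poly A)"
  unfolding prod
proof (rule has_annihilator_prod)
  have min: "is_min_poly A (char_poly A)"
    using is_min_poly_min_poly[OF A] assms(1) by (simp add: nonderogatory_def)
  fix i assume i: "i \<in> I"
  define h where "h = (\<Prod>j\<in>I - {i}. p j ^ e j)"
  obtain d where d: "e i = Suc d" using e[OF i] by (cases "e i") auto
  have fact: "char_poly A = p i ^ Suc d * h"
    unfolding prod h_def by (subst prod.remove[OF assms(2) i]) (simp add: d)
  have nz: "char_poly A \<noteq> 0" using min by (auto simp: is_min_poly_def)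
  have "degree (p i) \<noteq> 0"
    using prime_elem_not_unit[OF prime[OF i]] prime[OF i] by (auto simp: is_unit_iff_degree)
  then have "degree (p i ^ d * h) < degree (char_poly A)" "p i ^ d * h \<noteq> 0"
    using nz by (auto simp: fact degree_mult_eq mult.assoc)
  then have "poly_mat (p i ^ d * h) A \<noteq> 0\<^sub>m n n"
    using min leD unfolding is_min_poly_def dim_A by blast
  then obtain v where v: "v \<in> carrier_vec n" "act (p i ^ d * h) v \<noteq> 0\<^sub>v n"
    using mat_eq_zero_iff_mult_vec[OF poly_mat_closed] by (auto simp: act_def)
  moreover have "act (char_poly A) v = 0\<^sub>v n"
    using min v(1) by (auto simp: is_min_poly_def act_def intro!: eq_vecI)
  ultimately have "has_annihilator (act h v) (p i ^ Suc d)"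
    by (intro has_annihilator_prime_power prime i) (simp_all add: fact flip: act_mult)
  then show "\<exists>v. has_annihilator v (p i ^ e i)" by (auto simp: d)
qed (use assms(2) cop in auto)

text \<open>Lets the product of a Krylov matrix with a coefficient vector be read as the action of a
  polynomial.\<close>

lemma act_sum_monom:
  assumes "v \<in> carrier_vec n" "i < n"
  shows "act (\<Sum>j<N. monom (c j) j) v $ i = (\<Sum>j<N. c j * (A ^\<^sub>m j *\<^sub>v v) $ i)"
proof (induction N)
  case (Suc N)
  have *: "act (monom c j) v = c \<cdot>\<^sub>v (A ^\<^sub>m j *\<^sub>v v)" for c j
  proof (induction j)
    case 0
    then show ?case using A assms by (simp add: monom_0 act_pCons) (auto intro!: eq_vecI)
  next
    case (Suc j)
    have c: "A ^\<^sub>m j \<in> carrier_mat n n" by (rule pow_carrier_mat[OF A])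
    then have cv: "A ^\<^sub>m j *\<^sub>v v \<in> carrier_vec n" using assms(1) by (rule mult_mat_vec_carrier)
    have "act (monom c (Suc j)) v = 0 \<cdot>\<^sub>v v + A *\<^sub>v act (monom c j) v"
      by (simp only: monom_Suc act_pCons assms)
    also have "\<dots> = 0 \<cdot>\<^sub>v v + A *\<^sub>v (c \<cdot>\<^sub>v (A ^\<^sub>m j *\<^sub>v v))" by (simp only: Suc)
    also have "\<dots> = A *\<^sub>v (c \<cdot>\<^sub>v (A ^\<^sub>m j *\<^sub>v v))"
      using assms(1) by (rule zero_smult_add_vec) (rule mult_mat_vec_carrier[OF A smult_carrier_vec[THEN iffD2, OF cv]])
    also have "\<dots> = c \<cdot>\<^sub>v (A *\<^sub>v (A ^\<^sub>m j *\<^sub>v v))" by (rule mult_mat_vec[OF A cv])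
    also have "A *\<^sub>v (A ^\<^sub>m j *\<^sub>v v) = (A * A ^\<^sub>m j) *\<^sub>v v"
      by (rule assoc_mult_mat_vec[OF A c assms(1), symmetric])
    also have "A * A ^\<^sub>m j = A ^\<^sub>m Suc j"
      using pow_mat_add_exp[OF A, of 1 j] A by simp
    finally show ?case .
  qed
  have "dim_vec (A ^\<^sub>m N *\<^sub>v v) = n" using pow_carrier_mat[OF A, of N] by (simp del: pow_mat.simps)
  then show ?case using Suc assms by (simp add: act_add *)
qed (use assms in simp)

text \<open>\<open>K\<close> is the Krylov matrix with columns v, A v, ..., A^(n-1) v. A nonzero
  kernel vector would list the coefficients of a nonzero polynomial of degree below \<open>n\<close>
  annihilating \<open>v\<close>, which \<open>f\<close>, of degree \<open>n\<close>, cannot divide.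
  So \<open>K\<close> is invertible.\<close>

lemma cyclic_surj:
  assumes v: "has_annihilator v f" and deg: "degree f = n" and y: "y \<in> carrier_vec n"
  shows "\<exists>g. y = act g v"
proof -
  have vc: "v \<in> carrier_vec n" using v by (simp add: has_annihilator_def)
  define K where "K = mat n n (\<lambda>(i, j). (A ^\<^sub>m j *\<^sub>v v) $ i)"
  have K: "K \<in> carrier_mat n n" by (simp add: K_def)
  have K_mult: "K *\<^sub>v c = act (\<Sum>j<n. monom (c $ j) j) v" if "c \<in> carrier_vec n" for c
    using that vc K by (intro eq_vecI) (auto simp: K_def act_sum_monom scalar_prod_def atLeast0LessThan mult.commute)
  have "det K \<noteq> 0"
  proof
    assume "det K = 0"
    then obtain c where c: "c \<in> carrier_vec n" "c \<noteq> 0\<^sub>v n" "K *\<^sub>v c = 0\<^sub>v n"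
      using det_0_iff_vec_prod_zero_field[OF K] by blast
    define g where "g = (\<Sum>j<n. monom (c $ j) j)"
    have coeff: "coeff g k = (if k < n then c $ k else 0)" for k
      by (simp add: g_def coeff_sum sum.delta' if_distrib cong: if_cong)
    obtain k where "k < n" "c $ k \<noteq> 0" using c(1,2) by (metis carrier_vecD eq_vecI index_zero_vec)
    then have "g \<noteq> 0" "n > 0" using coeff[of k] by auto
    then have "degree g < n" by (intro le_less_trans[OF degree_le[of "n - 1"]]) (auto simp: coeff)
    moreover have "f dvd g" using c v K_mult by (auto simp: g_def has_annihilator_def)
    ultimately show False using \<open>g \<noteq> 0\<close> deg dvd_imp_degree_le[of f g] by auto
  qed
  then obtain B where B: "B \<in> carrier_mat n n" "K * B = 1\<^sub>m n"
    using det_non_zero_imp_unit[OF K, of "()"] by (auto simp: Units_def ring_mat_simps)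
  then have "K *\<^sub>v (B *\<^sub>v y) = y" using K y by (simp flip: assoc_mult_mat_vec)
  then show ?thesis using K_mult[of "B *\<^sub>v y"] B by (metis mult_mat_vec_carrier y)
qed

text \<open>A cyclic vector identifies both summands with R[X]/(f). For vectors this is the
  annihilator condition. For matrices, every vector has the form \<open>act g v\<close> and
  \<open>a\<close> sends it to \<open>act (a * g) v\<close>, so \<open>poly_mat a A\<close> is zero
  exactly when it kills \<open>v\<close>.\<close>

lemma presents_lie_G:
  assumes v: "has_annihilator v f" and deg: "degree f = n"
  shows "presents f (lie_G A)"
proof -
  have vc: "v \<in> carrier_vec n" using v by (simp add: has_annihilator_def)
  have ann: "act g v = 0\<^sub>v n \<longleftrightarrow> f dvd g" for g using v by (simp add: has_annihilator_def)
  have vec_eq: "act x v = act y v \<longleftrightarrow> f dvd x - y" for x y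
    unfolding ann[symmetric] act_diff[OF vc] by (auto simp: vec_eq_iff)
  have mat_zero: "poly_mat a A = 0\<^sub>m n n \<longleftrightarrow> f dvd a" for a
  proof -
    have "poly_mat a A = 0\<^sub>m n n \<longleftrightarrow> (\<forall>y\<in>carrier_vec n. act a y = 0\<^sub>v n)"
      using mat_eq_zero_iff_mult_vec[OF poly_mat_closed] by (simp add: act_def)
    also have "\<dots> \<longleftrightarrow> (\<forall>g. act a (act g v) = 0\<^sub>v n)"
      using cyclic_surj[OF v deg] act_closed by metis
    also have "\<dots> \<longleftrightarrow> (\<forall>g. f dvd a * g)" by (simp add: ann vc flip: act_mult)
    also have "\<dots> \<longleftrightarrow> f dvd a" by (metis dvd_mult2 mult.right_neutral)
    finally show ?thesis .
  qed
  have mat_eq: "poly_mat a A = poly_mat b A \<longleftrightarrow> f dvd a - b" for a b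
  proof -
    have "poly_mat a A = poly_mat (a - b) A + poly_mat b A" by (simp flip: poly_mat_add)
    then show ?thesis unfolding mat_zero[symmetric] by (auto simp: mat_eq_iff)
  qed
  have "presentation f (lie_G A) (\<lambda>a x. (poly_mat a A, act x v))"
  proof
    fix t assume "t \<in> carrier (lie_G A)"
    then show "\<exists>a x. t = (poly_mat a A, act x v)"
      using cyclic_surj[OF v deg] by (auto simp: lie_G_def Let_def poly_algebra_def)
  next
    fix a x b y
    have "poly_mat a A *\<^sub>v act y v - poly_mat b A *\<^sub>v act x v = act (a * y - b * x) v"
      by (simp add: act_diff vc act_mult) (simp add: act_def)
    then show "bracket (lie_G A) (poly_mat a A, act x v) (poly_mat b A, act y v) =
        (poly_mat 0 A, act (a * y - b * x) v)"
      using mat_zero[of 0] by (simp add: lie_G_def Let_def)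
  qed (auto simp: lie_G_def Let_def poly_algebra_def mat_eq vec_eq poly_mat_add poly_mat_smult act_add act_smult vc)
  then show ?thesis by (auto simp: presents_def)
qed

end

section \<open>Minimal polynomials of complex numbers over the reals\<close>

abbreviation cpoly :: "real poly \<Rightarrow> complex poly" where
  "cpoly \<equiv> map_poly complex_of_real"

lemma cpoly_mult: "cpoly (p * q) = cpoly p * cpoly q"
proof -
  interpret map_poly_comm_ring_hom "of_real :: real \<Rightarrow> complex" ..
  show ?thesis by (rule hom_mult)
qed

lemma cpoly_power: "cpoly (p ^ k) = cpoly p ^ k"
proof -
  interpret map_poly_comm_ring_hom "of_real :: real \<Rightarrow> complex" ..
  show ?thesis by (rule hom_power)
qed

text \<open>One family of primes for real and nonreal eigenvalues. The nonreal branch has the form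
  of the divisor in \<open>conj_pair_multiplicity\<close>.\<close>

definition real_min_poly :: "complex \<Rightarrow> real poly" where
  "real_min_poly w = (if w \<in> \<real> then [:- Re w, 1:] else [:- Re w, 1:]^2 + [:(Im w)^2:])"

lemma real_min_poly_of_real [simp]: "real_min_poly (of_real r) = [:- r, 1:]"
  by (simp add: real_min_poly_def)

lemma real_min_poly_nonreal:
  "w \<notin> \<real> \<Longrightarrow> real_min_poly w = [:- Re w, 1:]^2 + [:(Im w)^2:]"
  by (simp add: real_min_poly_def)

lemma degree_real_min_poly: "degree (real_min_poly w) = (if w \<in> \<real> then 1 else 2)"
  by (simp add: real_min_poly_def power2_eq_square)

lemma monic_real_min_poly: "monic (real_min_poly w)"
  by (simp add: real_min_poly_def power2_eq_square)

lemma real_min_poly_nz [simp]: "real_min_poly w \<noteq> 0"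
  using monic_real_min_poly[of w] by auto

lemma poly_real_min_poly:
  "poly (cpoly (real_min_poly w)) u = (if w \<in> \<real> then u - w else (u - w) * (u - cnj w))"
  by (auto simp: real_min_poly_def power2_eq_square complex_is_Real_iff complex_eq_iff algebra_simps)

text \<open>The remainder after division has degree 0, or at most 1 when \<open>w\<close> is
  nonreal. A real polynomial of that degree vanishes at \<open>w\<close> only if it is zero.\<close>

lemma real_min_poly_dvd_iff: "real_min_poly w dvd h \<longleftrightarrow> poly (cpoly h) w = 0"
proof
  assume "real_min_poly w dvd h"
  then obtain g where "h = real_min_poly w * g" ..
  then show "poly (cpoly h) w = 0"
    by (simp add: cpoly_mult poly_real_min_poly)
next
  assume h: "poly (cpoly h) w = 0"
  let ?p = "real_min_poly w"
  define r where "r = h mod ?p"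
  have "h = ?p * (h div ?p) + r" by (simp add: r_def)
  then have "cpoly h = cpoly ?p * cpoly (h div ?p) + cpoly r"
    by (metis cpoly_mult of_real_hom.map_poly_hom_add)
  then have "poly (cpoly h) w = poly (cpoly ?p) w * poly (cpoly (h div ?p)) w + poly (cpoly r) w"
    by (simp only: poly_add poly_mult)
  then have r0: "poly (cpoly r) w = 0"
    unfolding h poly_real_min_poly by (simp split: if_splits)
  have deg: "r = 0 \<or> degree r < degree ?p"
    unfolding r_def by (rule degree_mod_less) simp
  have "r = 0"
  proof (cases "w \<in> \<real>")
    case True
    then have "degree r = 0" using deg by (auto simp: degree_real_min_poly)
    then obtain c where "r = [:c:]" by (rule degree_eq_zeroE)
    then show ?thesis using r0 by (simp add: of_real_hom.map_poly_pCons_hom)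
  next
    case False
    then have "degree r \<le> 1" using deg by (auto simp: degree_real_min_poly)
    moreover obtain c s where r: "r = pCons c s" by (cases r)
    ultimately have "degree s = 0" by (simp split: if_splits)
    then obtain d where "s = [:d:]" by (rule degree_eq_zeroE)
    with r have r: "r = [:c, d:]" by simp
    with r0 have "complex_of_real c + w * complex_of_real d = 0" by (simp add: of_real_hom.map_poly_pCons_hom)
    then have "d * Im w = 0" "c + d * Re w = 0" by (auto simp: complex_eq_iff mult.commute)
    then show ?thesis using False r by (auto simp: complex_is_Real_iff)
  qed
  then show "?p dvd h" by (simp add: r_def mod_eq_0_iff_dvd)
qed

text \<open>Divisibility is vanishing at \<open>w\<close>, and the complex numbers have no zero
  divisors.\<close>

lemma prime_elem_real_min_poly: "prime_elem (real_min_poly w)"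
proof (rule prime_elemI)
  have "\<not> real_min_poly w dvd 1"
    unfolding real_min_poly_dvd_iff by simp
  then show "\<not> is_unit (real_min_poly w)" .
next
  fix g h assume "real_min_poly w dvd g * h"
  then show "real_min_poly w dvd g \<or> real_min_poly w dvd h"
    by (simp add: real_min_poly_dvd_iff cpoly_mult)
qed simp

lemma coprime_real_min_poly:
  assumes "u \<noteq> w" "u \<noteq> cnj w"
  shows "coprime (real_min_poly u) (real_min_poly w)"
proof (rule prime_elem_imp_coprime[OF prime_elem_real_min_poly])
  show "\<not> real_min_poly u dvd real_min_poly w"
    unfolding real_min_poly_dvd_iff poly_real_min_poly using assms by simp
qed

lemma poly_cpoly_cnj: "poly (cpoly h) (cnj w) = cnj (poly (cpoly h) w)"
  by (induction h) (simp_all add: of_real_hom.map_poly_pCons_hom)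

lemma monic_dvd_degree_eq:

  \<comment> \<open>Factoring monic real polynomials by their complex roots\<close>
  fixes f g :: "real poly"
  assumes "f dvd g" "monic f" "monic g" "degree f = degree g"
  shows "f = g"
proof -
  obtain h where h: "g = f * h" using assms(1) ..
  have nz: "f \<noteq> 0" "h \<noteq> 0" using assms(2,3) h by auto
  then have "degree h = 0" using assms(4) h by (simp add: degree_mult_eq)
  moreover have "lead_coeff h = 1" using assms(2,3) h by (simp add: lead_coeff_mult)
  ultimately have "h = 1" by (metis degree_eq_zeroE lead_coeff_pCons(2) one_pCons)
  then show ?thesis using h by simp
qed

lemma degree_prod_real_min_poly:
  "degree (\<Prod>i\<in>I. real_min_poly (w i) ^ e i) = (\<Sum>i\<in>I. e i * degree (real_min_poly (w i)))"
  by (subst degree_prod_sum_eq) (auto simp: degree_power_eq mult.commute)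

lemma monic_prod_real_min_poly: "monic (\<Prod>i\<in>I. real_min_poly (w i) ^ e i)"
  by (intro monic_prod monic_power monic_real_min_poly)

lemma prod_real_min_poly_dvd:
  assumes "finite I" "\<And>i. i \<in> I \<Longrightarrow> real_min_poly (w i) ^ e i dvd f"
    and "\<And>i j. i \<in> I \<Longrightarrow> j \<in> I \<Longrightarrow> i \<noteq> j \<Longrightarrow> w i \<noteq> w j \<and> w i \<noteq> cnj (w j)"
  shows "(\<Prod>i\<in>I. real_min_poly (w i) ^ e i) dvd f"
  by (rule prod_dvd_if_coprime) (use assms coprime_real_min_poly in \<open>auto intro!: coprime_power_left_iff[THEN iffD2] coprime_power_right_iff[THEN iffD2]\<close>)

text \<open>A nonconstant cofactor \<open>h\<close> would have a complex root. It is some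
  \<open>w i\<close> or its conjugate, and since \<open>h\<close> is real, \<open>w i\<close> is a
  root in either case; then \<open>real_min_poly (w i)\<close> divides \<open>h\<close>, against the
  maximality of \<open>e i\<close>.\<close>

lemma real_factorization:
  assumes I: "finite I" and f: "monic f"
    and cop: "\<And>i j. i \<in> I \<Longrightarrow> j \<in> I \<Longrightarrow> i \<noteq> j \<Longrightarrow> w i \<noteq> w j \<and> w i \<noteq> cnj (w j)"
    and roots: "\<And>u. poly (cpoly f) u = 0 \<Longrightarrow> \<exists>i\<in>I. u = w i \<or> u = cnj (w i)"
    and dvd: "\<And>i. i \<in> I \<Longrightarrow> real_min_poly (w i) ^ e i dvd f"
    and max: "\<And>i. i \<in> I \<Longrightarrow> \<not> real_min_poly (w i) ^ Suc (e i) dvd f"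
  shows "f = (\<Prod>i\<in>I. real_min_poly (w i) ^ e i)"
proof -
  let ?P = "\<Prod>i\<in>I. real_min_poly (w i) ^ e i"
  have "?P dvd f" by (rule prod_real_min_poly_dvd[OF I dvd cop])
  then obtain h where h: "f = ?P * h" ..
  have "degree h = 0"
  proof (rule ccontr)
    assume "degree h \<noteq> 0"
    then have "\<not> constant (poly (cpoly h))" by (simp add: constant_degree)
    then obtain u where u: "poly (cpoly h) u = 0" using fundamental_theorem_of_algebra by blast
    then have "poly (cpoly f) u = 0" by (simp add: h cpoly_mult)
    then obtain i where i: "i \<in> I" "u = w i \<or> u = cnj (w i)" using roots by blast
    then have "poly (cpoly h) (w i) = 0"
      using u poly_cpoly_cnj[of h "w i"] by auto
    then have "real_min_poly (w i) dvd h" by (simp add: real_min_poly_dvd_iff)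
    moreover have "real_min_poly (w i) ^ e i dvd ?P" by (rule dvd_prodI[OF I i(1)])
    ultimately have "real_min_poly (w i) ^ Suc (e i) dvd f"
      by (simp add: h mult_dvd_mono mult.commute)
    then show False using max i(1) by blast
  qed
  have "lead_coeff f = lead_coeff ?P * lead_coeff h"
    unfolding h by (rule lead_coeff_mult)
  then have "lead_coeff h = 1" using f monic_prod_real_min_poly[of w e I] by simp
  then have "h = 1" using \<open>degree h = 0\<close> by (metis degree_eq_zeroE lead_coeff_pCons(2) one_pCons)
  then show ?thesis using h by simp
qed

section \<open>Presentations of the model algebras\<close>

lemma pcompose_power: "pcompose (p ^ k) q = pcompose p q ^ k"
  for p q :: "'a::comm_semiring_1 poly"
  by (induction k) (simp_all add: pcompose_1 pcompose_mult)

lemma M0_mult_vec: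
  assumes "w \<in> carrier_vec n" "i < n"
  shows "(M0 n *\<^sub>v w) $ i = (if i + 1 < n then w $ (i + 1) else 0)"
proof -
  have "(M0 n *\<^sub>v w) $ i = (\<Sum>j<n. (if j = i + 1 then 1 else 0) * w $ j)"
    using assms by (simp add: M0_def scalar_prod_def atLeast0LessThan)
  also have "\<dots> = (\<Sum>j<n. if j = i + 1 then w $ j else 0)"
    by (intro sum.cong) auto
  finally show ?thesis by (simp add: sum.delta')
qed

text \<open>\<open>M0\<close> shifts coordinates, so the last basis vector is cyclic: the
  coordinates of g(M0) e are the lowest \<open>n\<close> coefficients of \<open>g\<close> in reverse
  order, all zero exactly when X^n divides \<open>g\<close>.\<close>

lemma presents_D0: "presents (monom 1 n) (D0 n)"
proof -
  interpret poly_action "M0 n" n by unfold_locales (simp add: M0_def)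
  define e :: "real vec" where "e = unit_vec n (n - 1)"
  have e: "e \<in> carrier_vec n" by (simp add: e_def)
  have coeffs: "act g e $ i = coeff g (n - 1 - i)" if "i < n" for g i
    using that
  proof (induction g arbitrary: i)
    case 0
    then show ?case using e by simp
  next
    case (pCons a g)
    have "act (pCons a g) e $ i = a * e $ i + (M0 n *\<^sub>v act g e) $ i"
      using pCons.prems e by (simp add: act_pCons del: index_mult_mat_vec)
    also have "\<dots> = coeff (pCons a g) (n - 1 - i)"
    proof (cases "i + 1 < n")
      case True
      then have "n - 1 - i = Suc (n - 1 - (i + 1))" by simp
      then show ?thesis
        using True pCons.IH[of "i + 1"] pCons.prems by (simp add: M0_mult_vec e_def del: index_mult_mat_vec)
    next
      case False
      then have "i = n - 1" using pCons.prems by simp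
      then show ?thesis using pCons.prems by (simp add: M0_mult_vec e_def del: index_mult_mat_vec)
    qed
    finally show ?case .
  qed
  have "act g e = 0\<^sub>v n \<longleftrightarrow> monom 1 n dvd g" for g
  proof -
    have "act g e = 0\<^sub>v n \<longleftrightarrow> (\<forall>i<n. coeff g (n - 1 - i) = 0)"
      by (auto simp: vec_eq_iff coeffs)
    also have "\<dots> \<longleftrightarrow> (\<forall>k<n. coeff g k = 0)"
    proof safe
      fix k assume "\<forall>i<n. coeff g (n - 1 - i) = 0" "k < n"
      then show "coeff g k = 0" by (auto dest!: spec[of _ "n - 1 - k"])
    qed auto
    finally show ?thesis by (simp add: monom_1_dvd_iff')
  qed
  then have "has_annihilator e (monom 1 n)" by (simp add: has_annihilator_def e)
  then show ?thesis unfolding D0_def by (rule presents_lie_G) (simp add: degree_monom_eq)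
qed

lemma real_min_poly_ii: "real_min_poly \<i> = [:1, 0, 1:]"
  by (simp add: real_min_poly_def power2_eq_square complex_is_Real_iff)

text \<open>With u_l = w_(2l) + i w_(2l+1), the two formulas say that the new l-th complex
  coordinate is i u_l + u_(l+1), where u_m counts as 0.\<close>

lemma M01_mult_vec:
  assumes "w \<in> carrier_vec (2 * m)" "l < m"
  shows "(M01 (2 * m) *\<^sub>v w) $ (2 * l) = - w $ (2 * l + 1) + (if l + 1 < m then w $ (2 * l + 2) else 0)"
    and "(M01 (2 * m) *\<^sub>v w) $ (2 * l + 1) = w $ (2 * l) + (if l + 1 < m then w $ (2 * l + 3) else 0)"
proof -
  have row: "(M01 (2 * m) *\<^sub>v w) $ i = (\<Sum>j<2 * m. M01 (2 * m) $$ (i, j) * w $ j)" if "i < 2 * m" for i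
    using assms(1) that by (simp add: M01_def scalar_prod_def atLeast0LessThan)
  have "(M01 (2 * m) *\<^sub>v w) $ (2 * l) =
      (\<Sum>j<2 * m. (if j = 2 * l + 1 then - w $ j else 0) + (if j = 2 * l + 2 then w $ j else 0))"
  proof (subst row)
    have "M01 (2 * m) $$ (2 * l, j) = (if j = 2 * l + 1 then - 1 else 0) + (if j = 2 * l + 2 then 1 else 0)"
      if "j < 2 * m" for j
    proof -
      have "\<not> (even j \<and> 2 * l = j + 1)" by presburger
      then show ?thesis using that assms(2) by (simp add: M01_def)
    qed
    then show "(\<Sum>j<2 * m. M01 (2 * m) $$ (2 * l, j) * w $ j) =
        (\<Sum>j<2 * m. (if j = 2 * l + 1 then - w $ j else 0) + (if j = 2 * l + 2 then w $ j else 0))"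
      by (intro sum.cong) auto
  qed (use assms(2) in simp)
  then show "(M01 (2 * m) *\<^sub>v w) $ (2 * l) = - w $ (2 * l + 1) + (if l + 1 < m then w $ (2 * l + 2) else 0)"
    using assms(2) by (simp add: sum.distrib sum.delta')
  have "(M01 (2 * m) *\<^sub>v w) $ (2 * l + 1) =
      (\<Sum>j<2 * m. (if j = 2 * l then w $ j else 0) + (if j = 2 * l + 3 then w $ j else 0))"
  proof (subst row)
    have "M01 (2 * m) $$ (2 * l + 1, j) = (if j = 2 * l then 1 else 0) + (if j = 2 * l + 3 then 1 else 0)"
      if "j < 2 * m" for j
      using that assms(2) by (auto simp: M01_def)
    then show "(\<Sum>j<2 * m. M01 (2 * m) $$ (2 * l + 1, j) * w $ j) =
        (\<Sum>j<2 * m. (if j = 2 * l then w $ j else 0) + (if j = 2 * l + 3 then w $ j else 0))"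
      by (intro sum.cong) auto
  qed (use assms(2) in simp)
  then show "(M01 (2 * m) *\<^sub>v w) $ (2 * l + 1) = w $ (2 * l) + (if l + 1 < m then w $ (2 * l + 3) else 0)"
    using assms(2) by (simp add: sum.distrib sum.delta')
qed

lemma presents_D01:
  assumes "m > 0"
  shows "presents (real_min_poly \<i> ^ m) (D01 (2 * m))"
proof -
  interpret poly_action "M01 (2 * m)" "2 * m" by unfold_locales (simp add: M01_def)
  \<comment> \<open>After pairing coordinates this is the last standard basis vector of C^m.\<close>
  define e :: "real vec" where "e = unit_vec (2 * m) (2 * (m - 1))"
  have e: "e \<in> carrier_vec (2 * m)" by (simp add: e_def)
  have e_idx: "e $ (2 * l) = (if l + 1 = m then 1 else 0)" "e $ (2 * l + 1) = 0" if "l < m" for l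
    using that Suc_double_not_eq_double[of l "m - 1"] by (auto simp del: diff_mult_distrib2 simp: e_def)
  define t where "t g = pcompose (cpoly g) [:\<i>, 1:]" for g
  \<comment> \<open>Pairing coordinates identifies \<open>\<real>\<^sup>2\<^sup>m\<close> with \<open>\<complex>\<^sup>m\<close>, on which \<open>M01\<close> is a complex Jordan block
    with eigenvalue \<open>\<i>\<close>; the coordinates of \<open>g(M) e\<close> are the Taylor coefficients of \<open>g\<close> at \<open>\<i>\<close>.\<close>
  have coeffs: "Complex (act g e $ (2 * l)) (act g e $ (2 * l + 1)) = coeff (t g) (m - 1 - l)"
    if "l < m" for g l
    using that
  proof (induction g arbitrary: l)
    case 0
    then show ?case using e by (simp add: t_def complex_eq_iff)
  next
    case (pCons a g)
    have t: "t (pCons a g) = [:complex_of_real a:] + [:\<i>, 1:] * t g"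
      by (simp add: t_def of_real_hom.map_poly_pCons_hom pcompose_pCons)
    have IH: "act g e $ (2 * i) = Re (coeff (t g) (m - 1 - i))"
      "act g e $ (2 * i + 1) = Im (coeff (t g) (m - 1 - i))" if "i < m" for i
      using pCons.IH[OF that] by (auto simp: complex_eq_iff)
    have IH': "act g e $ (2 * l + 2) = Re (coeff (t g) (m - 2 - l))"
      "act g e $ (2 * l + 3) = Im (coeff (t g) (m - 2 - l))" if "l + 1 < m"
      using IH[OF that] by (simp_all add: numeral_eq_Suc)
    have act: "act (pCons a g) e $ i = a * e $ i + (M01 (2 * m) *\<^sub>v act g e) $ i" if "i < 2 * m" for i
      using that e by (simp add: act_pCons del: index_mult_mat_vec)
    have "coeff (t (pCons a g)) (m - 1 - l) = (if l + 1 = m then complex_of_real a else 0) +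
        \<i> * coeff (t g) (m - 1 - l) + (if l + 1 < m then coeff (t g) (m - 2 - l) else 0)"
    proof (cases "l + 1 < m")
      case True
      then have "m - 1 - l = Suc (m - 2 - l)" by simp
      then show ?thesis using True by (simp add: t)
    next
      case False
      then have "l = m - 1" using pCons.prems by simp
      then show ?thesis using pCons.prems by (simp add: t)
    qed
    moreover have "act (pCons a g) e $ (2 * l) = a * e $ (2 * l) - act g e $ (2 * l + 1)
        + (if l + 1 < m then act g e $ (2 * l + 2) else 0)"
      using pCons.prems M01_mult_vec(1)[OF act_closed pCons.prems, of g e] by (subst act) auto
    moreover have "act (pCons a g) e $ (2 * l + 1) = act g e $ (2 * l)
        + (if l + 1 < m then act g e $ (2 * l + 3) else 0)"
      using pCons.prems M01_mult_vec(2)[OF act_closed pCons.prems, of g e] e_idx(2)[OF pCons.prems]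
      by (subst act) auto
    ultimately show ?case
      using IH[OF pCons.prems] IH' e_idx(1)[OF pCons.prems]
      by (cases "l + 1 < m") (simp_all add: complex_eq_iff)
  qed
  have t_mult: "t (g * h) = t g * t h" and t_power: "t (g ^ k) = t g ^ k" for g h k
    by (simp_all add: t_def cpoly_mult cpoly_power pcompose_mult pcompose_power)
  \<comment> \<open>X^2 + 1 = (X - i)(X + i), with X replaced by X + i.\<close>
  have t_p: "t (real_min_poly \<i>) = monom 1 1 * [:2 * \<i>, 1:]"
    by (simp add: t_def real_min_poly_ii of_real_hom.map_poly_pCons_hom pcompose_pCons monom_altdef)
  have t_pk: "t (real_min_poly \<i> ^ k) = monom 1 k * [:2 * \<i>, 1:] ^ k" for k
    unfolding t_power t_p power_mult_distrib monom_power by simp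
  obtain d where d: "m = Suc d" using assms by (cases m) auto
  have "act (real_min_poly \<i> ^ m) e $ i = 0" if "i < 2 * m" for i
  proof -
    have "i div 2 < m" using that by auto
    then have "Complex (act (real_min_poly \<i> ^ m) e $ (2 * (i div 2))) (act (real_min_poly \<i> ^ m) e $ (2 * (i div 2) + 1)) = 0"
      unfolding coeffs[OF \<open>i div 2 < m\<close>] t_pk by (simp add: coeff_monom_mult)
    moreover have "i = 2 * (i div 2) \<or> i = 2 * (i div 2) + 1" by auto
    ultimately show ?thesis by (metis Complex_eq_0)
  qed
  then have "act (real_min_poly \<i> ^ m) e = 0\<^sub>v (2 * m)" by (intro eq_vecI) simp_all
  then have zero: "act (real_min_poly \<i> ^ Suc d) e = 0\<^sub>v (2 * m)" by (simp only: d)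
  \<comment> \<open>Pair 0 holds the Taylor coefficient of order \<open>m - 1 = d\<close>, the
    lowest that can be nonzero for the exponent \<open>d\<close>. This shows that the exponent
    \<open>m\<close> cannot be lowered.\<close>
  have "coeff (t (real_min_poly \<i> ^ d)) (m - 1 - 0) = (2 * \<i>) ^ d"
    by (simp add: t_pk d coeff_monom_mult coeff_0_power)
  then have "Complex (act (real_min_poly \<i> ^ d) e $ (2 * 0)) (act (real_min_poly \<i> ^ d) e $ (2 * 0 + 1)) \<noteq> 0"
    by (subst coeffs) (use assms in auto)
  then have "act (real_min_poly \<i> ^ d) e \<noteq> 0\<^sub>v (2 * m)" using assms by (auto simp: Complex_eq_0)
  from has_annihilator_prime_power[OF prime_elem_real_min_poly e zero this]
  have "has_annihilator e (real_min_poly \<i> ^ m)" by (simp add: d)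
  then show ?thesis unfolding D01_def
    by (rule presents_lie_G) (simp add: degree_power_eq degree_real_min_poly complex_is_Real_iff)
qed

section \<open>The affine algebras of the real and the complex line\<close>

lemma presents_aff_R: "presents (monom 1 1) aff_R"
proof -
  have dvd: "monom 1 1 dvd g \<longleftrightarrow> poly g 0 = 0" for g :: "real poly"
    by (simp add: monom_1_dvd_iff' poly_0_coeff_0)
  \<comment> \<open>Evaluation at 0 identifies R[X]/(X) with R; coordinate 0 is the acting scalar
    and coordinate 1 the vector.\<close>
  let ?\<phi> = "\<lambda>a x. vec 2 (\<lambda>i. if i = 0 then poly a 0 else poly x 0)"
  have "presentation (monom 1 1) aff_R ?\<phi>"
  proof
    fix t assume "t \<in> carrier aff_R"
    then have "t = ?\<phi> [:t $ 0:] [:t $ 1:]"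
      by (auto simp: aff_R_def lie_of_brackets_def numeral_2_eq_2 less_Suc_eq intro!: eq_vecI)
    then show "\<exists>a x. t = ?\<phi> a x" by blast
  next
    fix a x b y :: "real poly"
    show "?\<phi> a x = ?\<phi> b y \<longleftrightarrow> monom 1 1 dvd a - b \<and> monom 1 1 dvd x - y"
      unfolding dvd by (auto simp: vec_eq_iff numeral_2_eq_2 less_Suc_eq)
  qed (auto simp: aff_R_def lie_of_brackets_def numeral_2_eq_2 less_Suc_eq lessThan_Suc intro!: eq_vecI)
  then show ?thesis by (auto simp: presents_def)
qed

text \<open>Evaluation at \<open>\<i>\<close> identifies R[X]/(X^2 + 1) with C. Basis vectors 0 and
  1 are 1 and i among the acting scalars, 2 and 3 are 1 and i in the space acted on, so the brackets
  are complex multiplication.\<close>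

lemma presents_aff_C: "presents (real_min_poly \<i>) aff_C"
proof -
  let ?P = "\<lambda>g. poly (cpoly g) \<i>"
  let ?\<phi> = "\<lambda>a x. vec 4 (\<lambda>i. if i = 0 then Re (?P a) else if i = 1 then Im (?P a)
    else if i = 2 then Re (?P x) else Im (?P x))"
  note P = cpoly_mult of_real_hom.map_poly_hom_add of_real_hom.map_poly_hom_smult
  have P_diff: "cpoly (g - h) = cpoly g - cpoly h" for g h
    by (intro poly_eqI) simp
  have "presentation (real_min_poly \<i>) aff_C ?\<phi>"
  proof
    fix t assume "t \<in> carrier aff_C"
    then have "t = ?\<phi> [:t $ 0, t $ 1:] [:t $ 2, t $ 3:]"
      by (auto simp: aff_C_def lie_of_brackets_def numeral_eq_Suc less_Suc_eq of_real_hom.map_poly_pCons_hom intro!: eq_vecI)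
    then show "\<exists>a x. t = ?\<phi> a x" by blast
  next
    fix a x b y :: "real poly"
    show "?\<phi> a x = ?\<phi> b y \<longleftrightarrow> real_min_poly \<i> dvd a - b \<and> real_min_poly \<i> dvd x - y"
      unfolding real_min_poly_dvd_iff P_diff
      by (auto simp: vec_eq_iff numeral_eq_Suc less_Suc_eq complex_eq_iff all_conj_distrib)
  next
    fix a x b y :: "real poly"
    show "bracket aff_C (?\<phi> a x) (?\<phi> b y) = ?\<phi> 0 (a * y - b * x)"
      by (auto simp: aff_C_def lie_of_brackets_def numeral_eq_Suc less_Suc_eq lessThan_Suc P P_diff algebra_simps intro!: eq_vecI)
  qed (auto simp: aff_C_def lie_of_brackets_def P intro!: eq_vecI)
  then show ?thesis by (auto simp: presents_def)
qed

section \<open>From the eigenvalues 0 and \<open>\<i>\<close> to arbitrary ones\<close>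

lemma presents_real_power:
  assumes "presents (monom 1 k) L"
  shows "presents (real_min_poly (of_real r) ^ k) L"
proof -
  have "pcompose (monom 1 k) [:- r, 1:] = [:- r, 1:] ^ k"
    by (simp add: monom_altdef pcompose_power pcompose_pCons)
  then show ?thesis using presents_pcompose_linear[OF assms, of 1 "- r"] by simp
qed

text \<open>For w = a + b i, the substitution X -> (X - a) / b turns X^2 + 1 into ((X - a)^2 + b^2)
  / b^2, and \<open>presents_cong_dvd\<close> removes the constant.\<close>

lemma presents_nonreal_power:
  assumes "presents (real_min_poly \<i> ^ k) L" "w \<notin> \<real>"
  shows "presents (real_min_poly w ^ k) L"
proof -
  define a b where "a = Re w" and "b = Im w"
  have b: "b \<noteq> 0" using assms(2) by (simp add: b_def complex_is_Real_iff)
  let ?g = "pcompose (real_min_poly \<i>) [:- a / b, 1 / b:]"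
  have "real_min_poly w = Polynomial.smult (b\<^sup>2) ?g"
    unfolding real_min_poly_nonreal[OF assms(2)] a_def[symmetric] b_def[symmetric]
    using b by (simp add: real_min_poly_ii pcompose_pCons field_simps power2_eq_square)
  then have *: "real_min_poly w ^ k = Polynomial.smult ((b\<^sup>2) ^ k) (?g ^ k)"
    by (simp add: smult_power)
  have "presents (?g ^ k) L"
    using presents_pcompose_linear[OF assms(1), of "1 / b" "- a / b"] b by (simp add: pcompose_power)
  then show ?thesis
    by (rule presents_cong_dvd) (use b in \<open>simp_all add: * smult_dvd_iff dvd_smult\<close>)
qed

section \<open>The decomposition theorem\<close>

lemma spectrum_complexify:
  assumes "M \<in> carrier_mat n n"
  shows "spectrum (complexify M) = {u. poly (cpoly (char_poly M)) u = 0}"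
  using spectrum_root_char_poly[of "complexify M" n] assms
  by (simp add: of_real_hom.char_poly_hom[OF assms])

lemma presents_nonderogatory:
  assumes M: "M \<in> carrier_mat n n" "nonderogatory M" and I: "finite I"
    and e: "\<And>i. i \<in> I \<Longrightarrow> e i > 0"
    and w: "\<And>i j. i \<in> I \<Longrightarrow> j \<in> I \<Longrightarrow> i \<noteq> j \<Longrightarrow> w i \<noteq> w j \<and> w i \<noteq> cnj (w j)"
    and prod: "char_poly M = (\<Prod>i\<in>I. real_min_poly (w i) ^ e i)"
  shows "presents (\<Prod>i\<in>I. real_min_poly (w i) ^ e i) (lie_G M)"
proof -
  interpret poly_action M n by unfold_locales (rule M)
  have "\<exists>v. has_annihilator v (char_poly M)"
    by (rule nonderogatory_imp_cyclic[OF M(2) I, of "\<lambda>i. real_min_poly (w i)" e])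
      (use prime_elem_real_min_poly e prod coprime_real_min_poly w in auto)
  then show ?thesis
    using presents_lie_G degree_monic_char_poly[OF M(1)] prod by auto
qed

lemma lie_G_iso_direct_sum:
  assumes "M \<in> carrier_mat n n" "nonderogatory M" "finite I"
    and "\<And>i. i \<in> I \<Longrightarrow> e i > 0"
    and w: "\<And>i j. i \<in> I \<Longrightarrow> j \<in> I \<Longrightarrow> i \<noteq> j \<Longrightarrow> w i \<noteq> w j \<and> w i \<noteq> cnj (w j)"
    and "char_poly M = (\<Prod>i\<in>I. real_min_poly (w i) ^ e i)"
    and L: "\<And>i. i \<in> I \<Longrightarrow> presents (real_min_poly (w i) ^ e i) (L i)"
  shows "lie_G M \<cong>\<^sub>L lie_direct_sum I L"
proof (rule presents_imp_lie_isomorphic)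
  show "presents (\<Prod>i\<in>I. real_min_poly (w i) ^ e i) (lie_direct_sum I L)"
    by (rule presents_direct_sum[OF assms(3) L]) (use w coprime_real_min_poly in auto)
qed (rule presents_nonderogatory[OF assms(1-6)])

section \<open>Multiplicities and the shape of the characteristic polynomial\<close>

lemma Greatest_power_dvd:
  fixes p f :: "real poly"
  assumes "degree p > 0" "f \<noteq> 0"
  shows "p ^ (GREATEST e. p ^ e dvd f) dvd f" "\<not> p ^ Suc (GREATEST e. p ^ e dvd f) dvd f"
proof -
  \<comment> \<open>\<open>GREATEST\<close> has a meaning only for a bounded set of exponents; the
    degree of \<open>f\<close> is the bound.\<close>
  have bound: "e \<le> degree f" if "p ^ e dvd f" for e
  proof -
    have "e \<le> e * degree p" using assms(1) by simp
    also have "\<dots> = degree (p ^ e)" using assms(1) by (subst degree_power_eq) auto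
    also have "\<dots> \<le> degree f" using that assms(2) by (rule dvd_imp_degree_le)
    finally show ?thesis .
  qed
  show "p ^ (GREATEST e. p ^ e dvd f) dvd f"
    by (rule GreatestI_nat[of "\<lambda>e. p ^ e dvd f" 0 "degree f"]) (use bound in auto)
  show "\<not> p ^ Suc (GREATEST e. p ^ e dvd f) dvd f"
    using Greatest_le_nat[of "\<lambda>e. p ^ e dvd f" "Suc (GREATEST e. p ^ e dvd f)" "degree f"] bound by auto
qed

text \<open>If two pairs met they would coincide, and omitting one index would leave the union
  unchanged with at most \<open>2 * (card J - 1)\<close> elements.\<close>

lemma card_conj_pairs_imp_distinct:
  assumes "finite J" "card (\<Union>j\<in>J. {z j, cnj (z j)}) = 2 * card J" "i \<in> J" "j \<in> J" "i \<noteq> j"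
  shows "z i \<noteq> z j \<and> z i \<noteq> cnj (z j)"
proof (rule ccontr)
  assume "\<not> ?thesis"
  then have "{z i, cnj (z i)} = {z j, cnj (z j)}" by auto
  then have "(\<Union>j\<in>J. {z j, cnj (z j)}) = (\<Union>j\<in>J - {i}. {z j, cnj (z j)})"
    using assms(3-5) by blast
  also have "card \<dots> \<le> (\<Sum>j\<in>J - {i}. card {z j, cnj (z j)})"
    using assms(1) by (intro card_UN_le) simp
  also have "\<dots> \<le> (\<Sum>j\<in>J - {i}. 2)" by (intro sum_mono) (simp add: card_insert_if)
  also have "\<dots> = 2 * card (J - {i})" by simp
  also have "\<dots> < 2 * card J" using card_Diff1_less[OF assms(1,3)] by linarith
  finally show False using assms(2) by simp
qed

text \<open>The product divides the characteristic polynomial and both are monic of degree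
  \<open>n\<close>, which forces all multiplicities to be 1. The exponent 1 keeps the shape expected
  by \<open>lie_G_iso_direct_sum\<close>.\<close>

lemma char_poly_eq_prod_real_min_poly:
  assumes M: "M \<in> carrier_mat n n" and I: "finite I"
    and w: "\<And>i j. i \<in> I \<Longrightarrow> j \<in> I \<Longrightarrow> i \<noteq> j \<Longrightarrow> w i \<noteq> w j \<and> w i \<noteq> cnj (w j)"
    and spec: "\<And>i. i \<in> I \<Longrightarrow> w i \<in> spectrum (complexify M)"
    and deg: "(\<Sum>i\<in>I. degree (real_min_poly (w i))) = n"
  shows "char_poly M = (\<Prod>i\<in>I. real_min_poly (w i) ^ 1)"
proof (rule sym, rule monic_dvd_degree_eq)
  show "(\<Prod>i\<in>I. real_min_poly (w i) ^ 1) dvd char_poly M"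
    by (rule prod_real_min_poly_dvd[OF I _ w])
      (use spec in \<open>auto simp: real_min_poly_dvd_iff spectrum_complexify[OF M]\<close>)
  show "monic (\<Prod>i\<in>I. real_min_poly (w i) ^ 1)" by (rule monic_prod_real_min_poly)
  show "degree (\<Prod>i\<in>I. real_min_poly (w i) ^ 1) = degree (char_poly M)"
    unfolding degree_prod_real_min_poly using deg degree_monic_char_poly[OF M] by simp
qed (use degree_monic_char_poly[OF M] in simp)

text \<open>Serves a single real eigenvalue and a single conjugate pair at once, since
  \<open>{w, cnj w}\<close> is a singleton for real \<open>w\<close>. It is
  \<open>real_factorization\<close> over a one-element index set.\<close>

lemma char_poly_eq_power_real_min_poly:
  assumes M: "M \<in> carrier_mat n n" and spec: "spectrum (complexify M) = {w, cnj w}"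
  obtains e where "e > 0" "char_poly M = real_min_poly w ^ e" "n = e * degree (real_min_poly w)"
proof -
  define f where "f = char_poly M"
  define e where "e = (GREATEST e. real_min_poly w ^ e dvd f)"
  have f: "monic f" "f \<noteq> 0" "degree f = n" using degree_monic_char_poly[OF M] by (auto simp: f_def)
  have "degree (real_min_poly w) > 0" by (simp add: degree_real_min_poly)
  note e = Greatest_power_dvd[OF this f(2), folded e_def]
  have roots: "poly (cpoly f) u = 0 \<longleftrightarrow> u = w \<or> u = cnj w" for u
    using spec spectrum_complexify[OF M] by (auto simp: f_def)
  have "f = (\<Prod>i\<in>{()}. real_min_poly w ^ e)"
    by (rule real_factorization[of "{()}" f "\<lambda>_. w" "\<lambda>_. e"]) (use f e roots in auto)
  then have fe: "f = real_min_poly w ^ e" by simp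
  have "real_min_poly w dvd f" by (simp add: real_min_poly_dvd_iff roots)
  then have "e > 0" using e(2) by (cases e) auto
  moreover have "n = e * degree (real_min_poly w)" using f(3) by (simp add: fe degree_power_eq mult.commute)
  ultimately show thesis using that fe by (simp add: f_def)
qed

section \<open>Real and conjugate eigenvalues, and the cases of the theorem\<close>

lemma spectrum_complexify_of_real:
  assumes "M \<in> carrier_mat n n"
  shows "complex_of_real r \<in> spectrum (complexify M) \<longleftrightarrow> r \<in> spectrum M"
  by (simp add: spectrum_complexify[OF assms] spectrum_root_char_poly[OF assms])

lemma spectrum_complexify_cnj:
  assumes "M \<in> carrier_mat n n"
  shows "cnj u \<in> spectrum (complexify M) \<longleftrightarrow> u \<in> spectrum (complexify M)"
  by (simp add: spectrum_complexify[OF assms] poly_cpoly_cnj)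

text \<open>The index set takes every real eigenvalue and one representative of each conjugate pair,
  which makes the factors coprime. The multiplicity hypotheses, \<open>order\<close> on one side and
  \<open>GREATEST\<close> on the other, give the maximal exponents that
  \<open>real_factorization\<close> asks for.\<close>

lemma lie_G_iso_general:
  fixes lam :: "nat \<Rightarrow> real" and z :: "nat \<Rightarrow> complex"
  assumes M: "M \<in> carrier_mat n n" "nonderogatory M"
    and lam: "bij_betw lam {1..p} (spectrum M)"
    and k: "\<forall>i\<in>{1..p}. k i = order (lam i) (char_poly M)"
    and z: "{w \<in> spectrum (complexify M). w \<notin> \<real>} = (\<Union>j\<in>{1..q}. {z j, cnj (z j)})"
    and card: "card (\<Union>j\<in>{1..q}. {z j, cnj (z j)}) = 2 * q"
    and m: "\<forall>j\<in>{1..q}. m j = conj_pair_multiplicity M (z j)"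
  shows "n = (\<Sum>i\<in>{1..p}. k i) + 2 * (\<Sum>j\<in>{1..q}. m j) \<and>
    lie_G M \<cong>\<^sub>L lie_direct_sum ({1..p} <+> {1..q}) (case_sum (\<lambda>i. D0 (k i)) (\<lambda>j. D01 (2 * m j)))"
proof -
  define f where "f = char_poly M"
  define I where "I = {1..p} <+> {1..q}"
  define w where "w = case_sum (\<lambda>i. complex_of_real (lam i)) z"
  define e where "e = case_sum k m"
  have f: "monic f" "f \<noteq> 0" "degree f = n" using degree_monic_char_poly[OF M(1)] by (auto simp: f_def)
  have I: "finite I" by (simp add: I_def)
  have z_nonreal: "z j \<notin> \<real>" and z_root: "z j \<in> spectrum (complexify M)" if "j \<in> {1..q}" for j
    using z that by blast+
  have lam_root: "lam i \<in> spectrum M" if "i \<in> {1..p}" for i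
    using lam that by (auto simp: bij_betw_def)
  have z_neq: "z i \<noteq> z j \<and> z i \<noteq> cnj (z j)" if "i \<in> {1..q}" "j \<in> {1..q}" "i \<noteq> j" for i j
    by (rule card_conj_pairs_imp_distinct[of "{1..q}"]) (use card that in auto)
  have lam_z: "complex_of_real r \<noteq> z j" "complex_of_real r \<noteq> cnj (z j)" "z j \<noteq> complex_of_real r"
    if "j \<in> {1..q}" for r j
    using z_nonreal[OF that] Reals_of_real by (metis complex_cnj_cnj complex_cnj_complex_of_real)+
  have w: "w i \<noteq> w j \<and> w i \<noteq> cnj (w j)" if "i \<in> I" "j \<in> I" "i \<noteq> j" for i j
    using that z_neq lam_z lam by (auto simp: I_def w_def bij_betw_def inj_on_def)
  have root: "poly (cpoly f) (w i) = 0" if "i \<in> I" for i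
    using that z_root lam_root spectrum_complexify_of_real[OF M(1)] spectrum_complexify[OF M(1)]
    by (auto simp: I_def w_def f_def)
  have roots: "\<exists>i\<in>I. u = w i \<or> u = cnj (w i)" if "poly (cpoly f) u = 0" for u
  proof -
    have u: "u \<in> spectrum (complexify M)" using that by (simp add: f_def spectrum_complexify[OF M(1)])
    show ?thesis
    proof (cases "u \<in> \<real>")
      case True
      then obtain r where r: "u = complex_of_real r" by (auto elim: Reals_cases)
      with u have "r \<in> lam ` {1..p}"
        using lam spectrum_complexify_of_real[OF M(1)] by (simp add: bij_betw_def)
      then obtain i where "i \<in> {1..p}" "r = lam i" by blast
      then show ?thesis by (intro bexI[of _ "Inl i"]) (auto simp: w_def I_def r)
    next
      case False
      then have "u \<in> (\<Union>j\<in>{1..q}. {z j, cnj (z j)})" using u z by blast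
      then obtain j where "j \<in> {1..q}" "u = z j \<or> u = cnj (z j)" by blast
      then show ?thesis by (intro bexI[of _ "Inr j"]) (auto simp: w_def I_def)
    qed
  qed
  have "real_min_poly (w i) ^ e i dvd f \<and> \<not> real_min_poly (w i) ^ Suc (e i) dvd f" if "i \<in> I" for i
    using that unfolding I_def
  proof (rule PlusE)
    fix j assume j: "j \<in> {1..p}" "i = Inl j"
    then show ?thesis
      using order_1[of "lam j" f] order_2[of f "lam j"] f(2) k by (simp add: w_def e_def f_def)
  next
    fix j assume j: "j \<in> {1..q}" "i = Inr j"
    then have "m j = (GREATEST e. real_min_poly (z j) ^ e dvd f)"
      using m by (simp add: conj_pair_multiplicity_def real_min_poly_nonreal[OF z_nonreal] f_def)
    then show ?thesis
      using Greatest_power_dvd[of "real_min_poly (z j)" f] f(2) j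
      by (simp add: w_def e_def degree_real_min_poly)
  qed
  then have dvd: "\<And>i. i \<in> I \<Longrightarrow> real_min_poly (w i) ^ e i dvd f"
    and max: "\<And>i. i \<in> I \<Longrightarrow> \<not> real_min_poly (w i) ^ Suc (e i) dvd f" by blast+
  \<comment> \<open>Exponent 0 would contradict maximality, because \<open>w i\<close> is a
    root.\<close>
  have e: "e i > 0" if "i \<in> I" for i
    using max[OF that] root[OF that] by (cases "e i") (auto simp: real_min_poly_dvd_iff)
  have prod: "char_poly M = (\<Prod>i\<in>I. real_min_poly (w i) ^ e i)"
    unfolding f_def[symmetric] by (rule real_factorization[OF I f(1) w roots dvd max])
  have "n = (\<Sum>i\<in>I. e i * degree (real_min_poly (w i)))"
    using f(3) unfolding f_def prod degree_prod_real_min_poly by simp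
  also have "\<dots> = (\<Sum>i\<in>{1..p}. k i) + (\<Sum>j\<in>{1..q}. m j * 2)"
    unfolding I_def by (subst sum.Plus) (use z_nonreal in \<open>auto simp: e_def w_def degree_real_min_poly\<close>)
  finally have n: "n = (\<Sum>i\<in>{1..p}. k i) + 2 * (\<Sum>j\<in>{1..q}. m j)"
    by (simp add: sum_distrib_left mult.commute)
  have "presents (real_min_poly (w i) ^ e i) (case_sum (\<lambda>i. D0 (k i)) (\<lambda>j. D01 (2 * m j)) i)"
    if "i \<in> I" for i
    using that e[OF that] unfolding I_def
    by (auto simp: w_def e_def intro!: presents_real_power[OF presents_D0, unfolded real_min_poly_of_real]
        presents_nonreal_power[OF presents_D01] z_nonreal)
  then have "lie_G M \<cong>\<^sub>L lie_direct_sum I (case_sum (\<lambda>i. D0 (k i)) (\<lambda>j. D01 (2 * m j)))"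
    by (intro lie_G_iso_direct_sum[OF M I e w prod])
  with n show ?thesis by (simp add: I_def)
qed

lemma lie_G_iso_distinct_real:
  assumes M: "M \<in> carrier_mat n n" "nonderogatory M" and card: "card (spectrum M) = n"
  shows "lie_G M \<cong>\<^sub>L lie_direct_sum {1..n} (\<lambda>_. aff_R)"
proof -
  obtain h where h: "bij_betw h {1..n} (spectrum M)"
    using ex_bij_betw_nat_finite_1[OF card_finite_spectrum(1)[OF M(1)]] card by auto
  let ?w = "\<lambda>i. complex_of_real (h i)"
  have w: "?w i \<noteq> ?w j \<and> ?w i \<noteq> cnj (?w j)" if "i \<in> {1..n}" "j \<in> {1..n}" "i \<noteq> j" for i j
    using inj_onD[OF bij_betw_imp_inj_on[OF h], of i j] that by auto
  have prod: "char_poly M = (\<Prod>i\<in>{1..n}. real_min_poly (?w i) ^ 1)"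
  proof (rule char_poly_eq_prod_real_min_poly[where w = ?w, OF M(1) _ w])
    show "?w i \<in> spectrum (complexify M)" if "i \<in> {1..n}" for i
      using h that unfolding spectrum_complexify_of_real[OF M(1)] bij_betw_def by blast
  qed simp_all
  show ?thesis
  proof (rule lie_G_iso_direct_sum[where w = ?w and e = "\<lambda>_. 1", OF M _ _ w prod])
    show "presents (real_min_poly (?w i) ^ 1) aff_R" for i
      by (rule presents_real_power[OF presents_aff_R])
  qed simp_all
qed

lemma lie_G_iso_distinct_nonreal:
  assumes M: "M \<in> carrier_mat n n" "nonderogatory M"
    and card: "card {w \<in> spectrum (complexify M). w \<notin> \<real>} = n"
  shows "lie_G M \<cong>\<^sub>L lie_direct_sum {1..n div 2} (\<lambda>_. aff_C)"
proof -
  \<comment> \<open>The upper half plane holds exactly one member of each conjugate pair of nonreal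
    eigenvalues.\<close>
  define Z where "Z = {w \<in> spectrum (complexify M). Im w > 0}"
  have fin: "finite Z"
    using card_finite_spectrum(1)[of "complexify M" n] M(1) by (simp add: Z_def)
  have "{w \<in> spectrum (complexify M). w \<notin> \<real>} = Z \<union> cnj ` Z"
  proof (intro equalityI subsetI)
    fix u assume "u \<in> {w \<in> spectrum (complexify M). w \<notin> \<real>}"
    then have u: "u \<in> spectrum (complexify M)" "Im u > 0 \<or> Im u < 0" by (auto simp: complex_is_Real_iff)
    then have "u \<in> Z \<or> cnj u \<in> Z" by (auto simp: Z_def spectrum_complexify_cnj[OF M(1)])
    then show "u \<in> Z \<union> cnj ` Z" using image_eqI[of u cnj "cnj u" Z] by auto
  qed (auto simp: Z_def complex_is_Real_iff spectrum_complexify_cnj[OF M(1)])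
  moreover have "card (Z \<union> cnj ` Z) = card Z + card (cnj ` Z)"
    using fin by (intro card_Un_disjoint) (auto simp: Z_def)
  moreover have "card (cnj ` Z) = card Z" by (intro card_image) (auto simp: inj_on_def)
  ultimately have n: "n = 2 * card Z" using card by simp
  have "n div 2 = card Z" using n by simp
  then obtain h where h: "bij_betw h {1..n div 2} Z"
    using ex_bij_betw_nat_finite_1[OF fin] by metis
  then have hZ: "h i \<in> Z" if "i \<in> {1..n div 2}" for i using bij_betwE[OF h] that by blast
  then have nonreal: "h i \<notin> \<real>" if "i \<in> {1..n div 2}" for i
    using hZ[OF that] by (auto simp: Z_def complex_is_Real_iff)
  have w: "h i \<noteq> h j \<and> h i \<noteq> cnj (h j)" if "i \<in> {1..n div 2}" "j \<in> {1..n div 2}" "i \<noteq> j" for i j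
  proof
    show "h i \<noteq> h j" using inj_onD[OF bij_betw_imp_inj_on[OF h], of i j] that by blast
    show "h i \<noteq> cnj (h j)" using hZ[OF that(1)] hZ[OF that(2)] by (auto simp: Z_def)
  qed
  have prod: "char_poly M = (\<Prod>i\<in>{1..n div 2}. real_min_poly (h i) ^ 1)"
  proof (rule char_poly_eq_prod_real_min_poly[where w = h, OF M(1) _ w])
    show "(\<Sum>i\<in>{1..n div 2}. degree (real_min_poly (h i))) = n"
    proof -
      have "(\<Sum>i\<in>{1..n div 2}. degree (real_min_poly (h i))) = (\<Sum>i\<in>{1..n div 2}. 2)"
        by (intro sum.cong refl) (simp add: degree_real_min_poly nonreal del: atLeastAtMost_iff)
      also have "\<dots> = n" unfolding \<open>n div 2 = card Z\<close> n by simp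
      finally show ?thesis .
    qed
    show "h i \<in> spectrum (complexify M)" if "i \<in> {1..n div 2}" for i
      using hZ[OF that] by (simp add: Z_def)
  qed (rule finite_atLeastAtMost)
  show ?thesis
  proof (rule lie_G_iso_direct_sum[where w = h and e = "\<lambda>_. 1", OF M _ _ w prod])
    show "presents (real_min_poly (h i) ^ 1) aff_C" if "i \<in> {1..n div 2}" for i
      by (rule presents_nonreal_power[OF _ nonreal[OF that]]) (simp add: presents_aff_C)
  qed (simp_all only: finite_atLeastAtMost zero_less_one not_False_eq_True)
qed

lemma lie_G_iso_power:
  assumes M: "M \<in> carrier_mat n n" "nonderogatory M"
    and prod: "char_poly M = real_min_poly w ^ e" and "e > 0"
    and L: "presents (real_min_poly w ^ e) L"
  shows "lie_G M \<cong>\<^sub>L L"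
proof (rule presents_imp_lie_isomorphic[OF _ L])
  show "presents (real_min_poly w ^ e) (lie_G M)"
    using presents_nonderogatory[OF M, of "{()}" "\<lambda>_. e" "\<lambda>_. w"] assms(3,4) by simp
qed

theorem theorem7p1:
  fixes M :: "real mat" and n :: nat
  assumes M: "M \<in> carrier_mat n n"
    and nonderog: "nonderogatory M"
  shows
    "(\<forall>(p::nat) (q::nat) (lam :: nat \<Rightarrow> real) (k :: nat \<Rightarrow> nat) (z :: nat \<Rightarrow> complex) (m :: nat \<Rightarrow> nat).
        bij_betw lam {1..p} (spectrum M) \<and>
        (\<forall>i\<in>{1..p}. k i = order (lam i) (char_poly M)) \<and>
        {w \<in> spectrum (complexify M). w \<notin> \<real>} = (\<Union>j\<in>{1..q}. {z j, cnj (z j)}) \<and>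
        card (\<Union>j\<in>{1..q}. {z j, cnj (z j)}) = 2 * q \<and>
        (\<forall>j\<in>{1..q}. m j = conj_pair_multiplicity M (z j))
        \<longrightarrow> n = (\<Sum>i\<in>{1..p}. k i) + 2 * (\<Sum>j\<in>{1..q}. m j) \<and>
            lie_G M \<cong>\<^sub>L lie_direct_sum ({1..p} <+> {1..q}) (case_sum (\<lambda>i. D0 (k i)) (\<lambda>j. D01 (2 * m j))))
     \<and> (card (spectrum M) = n \<longrightarrow> lie_G M \<cong>\<^sub>L lie_direct_sum {1..n} (\<lambda>_. aff_R))
     \<and> ((\<exists>lam::real. spectrum (complexify M) = {complex_of_real lam}) \<longrightarrow> lie_G M \<cong>\<^sub>L D0 n)
     \<and> (card {w \<in> spectrum (complexify M). w \<notin> \<real>} = n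
          \<longrightarrow> lie_G M \<cong>\<^sub>L lie_direct_sum {1..n div 2} (\<lambda>_. aff_C))
     \<and> ((\<exists>z w. z \<noteq> w \<and> z \<notin> \<real> \<and> w \<notin> \<real> \<and> spectrum (complexify M) = {z, w}) \<longrightarrow> lie_G M \<cong>\<^sub>L D01 n)"
proof (intro conjI, goal_cases)
  case 1
  show ?case
    by (intro allI impI, elim conjE, rule lie_G_iso_general[OF assms]) assumption+
next
  case 2
  show ?case by (intro impI lie_G_iso_distinct_real[OF assms])
next
  case 3
  show ?case
  proof (intro impI, elim exE)
    fix r assume "spectrum (complexify M) = {complex_of_real r}"
    \<comment> \<open>A real number is its own conjugate, which brings the spectrum into the
      one-pair form.\<close>
    then have "spectrum (complexify M) = {complex_of_real r, cnj (complex_of_real r)}" by simp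
    then obtain e where e: "e > 0" "char_poly M = real_min_poly (complex_of_real r) ^ e"
        "n = e * degree (real_min_poly (complex_of_real r))"
      by (rule char_poly_eq_power_real_min_poly[OF M])
    have "n = e" using e(3) by simp
    then show "lie_G M \<cong>\<^sub>L D0 n"
      using lie_G_iso_power[OF assms e(2,1) presents_real_power[OF presents_D0]] by simp
  qed
next
  case 4
  show ?case by (intro impI lie_G_iso_distinct_nonreal[OF assms])
next
  case 5
  show ?case
  proof (intro impI, elim exE conjE)
    fix z w :: complex
    assume zw: "z \<noteq> w" "z \<notin> \<real>" "w \<notin> \<real>" "spectrum (complexify M) = {z, w}"
    \<comment> \<open>The spectrum of a real matrix is closed under conjugation; as \<open>z\<close>
      is nonreal, this forces \<open>w = cnj z\<close>.\<close>
    then have "cnj z \<in> {z, w}" using spectrum_complexify_cnj[OF M, of z] by simp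
    moreover have "cnj z \<noteq> z" using zw(2) by (simp add: Reals_cnj_iff)
    ultimately have "spectrum (complexify M) = {z, cnj z}" using zw(4) by simp
    then obtain e where e: "e > 0" "char_poly M = real_min_poly z ^ e"
        "n = e * degree (real_min_poly z)"
      by (rule char_poly_eq_power_real_min_poly[OF M])
    have "n = 2 * e" using e(3) zw(2) by (simp add: degree_real_min_poly)
    then show "lie_G M \<cong>\<^sub>L D01 n"
      using lie_G_iso_power[OF assms e(2,1) presents_nonreal_power[OF presents_D01[OF e(1)] zw(2)]]
      by simp
  qed
qed

end
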